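(* Let $M$ be a $4$-dimensional closed Riemannian spin manifold. At the center $x$ of a Riemannian normal coordinate system, with summation over all repeated indices, $$\mathrm{sres}_x\left(|\xi|^{-4}\,\partial_{x_a}\Gamma_{ij}^{k}\,\partial_{x_a}\Gamma_{im}^{n}\,\sigma_{kj}\sigma_{nm}\right)dx=\frac{1}{32\,\pi^2}\,\mathrm{tr}(R\wedge R)$$ and $$\mathrm{sres}_x\left(\frac{\xi_a\xi_b}{|\xi|^{6}}\,\partial_{x_a}\Gamma_{ij}^{k}\,\partial_{x_b}\Gamma_{im}^{n}\,\sigma_{kj}\sigma_{nm}\right)dx=\frac{1}{4\times32\,\pi^2}\,\mathrm{tr}(R\wedge R).$$
   Context: All indices (including the index $n$ in $\Gamma_{im}^n$) run from $1$ to $4$. $\gamma_i=c(e_i)$ is Clifford multiplication on the spinor bundle $S$ (complex rank $4$) with $\gamma_i\gamma_j+\gamma_j\gamma_i=-2\delta_{ij}$, in the oriented orthonormal frame given by the normal coordinates at $x$; $\sigma_{ij}=\frac18[\gamma_i,\gamma_j]$ (so $\sigma_{ij}=\frac14\gamma_i\gamma_j$ for $i\ne j$). The supertrace is $\mathrm{str}=\mathrm{tr}\circ\Gamma$ with grading operator $\Gamma=i^2\gamma_1\gamma_2\gamma_3\gamma_4$. For an $\mathrm{End}(S)$-valued symbol $\sigma$, positively homogeneous of degree $-4$ in $\xi$, $\mathrm{sres}_x(\sigma)=\frac{1}{(2\pi)^4}\int_{|\xi|=1}\mathrm{str}(\sigma(x,\xi))\,d\xi$. $\Gamma_{ij}^k=\frac12g^{kl}(\partial_jg_{il}+\partial_ig_{jl}-\partial_lg_{ij})$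 are the Christoffel symbols, and the sign convention for the curvature tensor is that in normal coordinates $g_{ij}=\delta_{ij}-\frac13R_{ikjl}x^kx^l+O(|x|^3)$. $R$ in $\mathrm{tr}(R\wedge R)$ is the matrix of two-forms $R_{ij}=\frac12R_{ijkl}\,dx^k\wedge dx^l$, so $\mathrm{tr}(R\wedge R)=\sum_{i,j}R_{ij}\wedge R_{ji}$. *)

theory Defs
  imports "HOL-Analysis.Analysis"
begin

text \<open>
  The index set \<open>{1,2,3,4}\<close> is the numeral type \<^typ>\<open>4\<close>, in which \<open>4 = 0\<close>.
\<close>


section \<open>Coordinate calculus\<close>

definition partial_deriv ::
    "'n::finite \<Rightarrow> (real^'n \<Rightarrow> 'b::real_normed_vector) \<Rightarrow> real^'n \<Rightarrow> 'b" where
  "partial_deriv a f x = vector_derivative (\<lambda>t. f (x + t *\<^sub>R axis a 1)) (at 0)"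

text \<open>
  \<open>C\<^sup>\<infinity>\<close> on an open set: every iterated partial derivative (including \<open>f\<close> itself, for the
  empty list of indices) is differentiable there.
\<close>
definition smooth_on ::
    "(real^'n::finite) set \<Rightarrow> (real^'n \<Rightarrow> 'b::real_normed_vector) \<Rightarrow> bool" where
  "smooth_on S f \<longleftrightarrow> open S \<and> (\<forall>as. foldr partial_deriv as f differentiable_on S)"


section \<open>Oriented closed 4-manifolds\<close>

text \<open>
  A chart is a domain together with a coordinate map, whose values outside the domain are
  irrelevant.
\<close>
type_synonym 'm chart = "'m set \<times> ('m \<Rightarrow> real^4)"

definition is_chart :: "'m topology \<Rightarrow> 'm chart \<Rightarrow> bool" where
  "is_chart X c \<longleftrightarrow>
     openin X (fst c) \<and> open (snd c ` fst c) \<and>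
     homeomorphic_map (subtopology X (fst c)) (top_of_set (snd c ` fst c)) (snd c)"

definition chart_inv :: "'m chart \<Rightarrow> real^4 \<Rightarrow> 'm" where
  "chart_inv c = inv_into (fst c) (snd c)"

definition transition :: "'m chart \<Rightarrow> 'm chart \<Rightarrow> real^4 \<Rightarrow> real^4" where
  "transition c d = snd d \<circ> chart_inv c"

definition transition_jac :: "'m chart \<Rightarrow> 'm chart \<Rightarrow> 'm \<Rightarrow> real^4^4" where
  "transition_jac c d p = jacobian (transition c d) (at (snd c p))"

definition oriented_compatible :: "'m chart \<Rightarrow> 'm chart \<Rightarrow> bool" where
  "oriented_compatible c d \<longleftrightarrow>
     smooth_on (snd c ` (fst c \<inter> fst d)) (transition c d) \<and>
     smooth_on (snd d ` (fst c \<inter> fst d)) (transition d c) \<and>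
     (\<forall>p\<in>fst c \<inter> fst d. det (transition_jac c d p) > 0)"

text \<open>
  The oriented smooth structure is given by its maximal oriented atlas \<open>A\<close>.
\<close>
locale closed_oriented_4manifold =
  fixes X :: "'m topology" and A :: "'m chart set"
  assumes hausdorff: "Hausdorff_space X"
    and second_countable: "second_countable X"
    and compact: "compact_space X"
    and charts: "\<And>c. c \<in> A \<Longrightarrow> is_chart X c"
    and cover: "(\<Union>c\<in>A. fst c) = topspace X"
    and compatible: "\<And>c d. c \<in> A \<Longrightarrow> d \<in> A \<Longrightarrow> oriented_compatible c d"
    and maximal: "\<And>c. is_chart X c \<Longrightarrow> (\<forall>d\<in>A. oriented_compatible c d) \<Longrightarrow> c \<in> A"


section \<open>Riemannian metrics\<close>

text \<open>
  A metric is given by its coefficients: \<open>g c p $ i $ j\<close> is the inner product of the \<open>i\<close>-th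
  and \<open>j\<close>-th coordinate vector fields of the chart \<open>c\<close> at the point \<open>p\<close>.
\<close>
type_synonym 'm metric = "'m chart \<Rightarrow> 'm \<Rightarrow> real^4^4"

definition metric_coords :: "'m metric \<Rightarrow> 'm chart \<Rightarrow> real^4 \<Rightarrow> real^4^4" where
  "metric_coords g c y = g c (chart_inv c y)"

locale closed_riemannian_4manifold = closed_oriented_4manifold X A
  for X :: "'m topology" and A :: "'m chart set" +
  fixes g :: "'m metric"
  assumes metric_smooth: "\<And>c. c \<in> A \<Longrightarrow> smooth_on (snd c ` fst c) (metric_coords g c)"
    and metric_sym: "\<And>c p. c \<in> A \<Longrightarrow> p \<in> fst c \<Longrightarrow> transpose (g c p) = g c p"
    and metric_pos: "\<And>c p v. c \<in> A \<Longrightarrow> p \<in> fst c \<Longrightarrow> v \<noteq> 0 \<Longrightarrow> v \<bullet> (g c p *v v) > 0"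
    and metric_change: "\<And>c d p. c \<in> A \<Longrightarrow> d \<in> A \<Longrightarrow> p \<in> fst c \<inter> fst d \<Longrightarrow>
      g c p = transpose (transition_jac c d p) ** g d p ** transition_jac c d p"

text \<open>
  \<open>christoffel G i j k\<close> is \<open>\<Gamma>\<^sub>i\<^sub>j\<^sup>k\<close>, for a metric with coefficient matrix \<open>G\<close> in the given
  coordinates.
\<close>
definition christoffel ::
    "(real^4 \<Rightarrow> real^4^4) \<Rightarrow> 4 \<Rightarrow> 4 \<Rightarrow> 4 \<Rightarrow> real^4 \<Rightarrow> real" where
  "christoffel G i j k y =
     1/2 * (\<Sum>l\<in>UNIV. matrix_inv (G y) $ k $ l *
       (partial_deriv j (\<lambda>z. G z $ i $ l) y + partial_deriv i (\<lambda>z. G z $ j $ l) y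
        - partial_deriv l (\<lambda>z. G z $ i $ j) y))"

text \<open>
  \<open>R\<^sub>i\<^sub>j\<^sub>k\<^sub>l = \<langle>R(\<partial>\<^sub>k,\<partial>\<^sub>l)\<partial>\<^sub>j, \<partial>\<^sub>i\<rangle>\<close> with
  \<open>R(X,Y) = \<nabla>\<^sub>X\<nabla>\<^sub>Y - \<nabla>\<^sub>Y\<nabla>\<^sub>X - \<nabla>\<^sub>[\<^sub>X\<^sub>,\<^sub>Y\<^sub>]\<close>. On the unit sphere this is
  \<open>g\<^sub>i\<^sub>k g\<^sub>j\<^sub>l - g\<^sub>i\<^sub>l g\<^sub>j\<^sub>k\<close>; it is the sign for which
  \<open>g\<^sub>i\<^sub>j = \<delta>\<^sub>i\<^sub>j - 1/3 R\<^sub>i\<^sub>k\<^sub>j\<^sub>l x\<^sup>k x\<^sup>l + O(|x|\<^sup>3)\<close> in normal coordinates.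
\<close>
definition riemann ::
    "(real^4 \<Rightarrow> real^4^4) \<Rightarrow> 4 \<Rightarrow> 4 \<Rightarrow> 4 \<Rightarrow> 4 \<Rightarrow> real^4 \<Rightarrow> real" where
  "riemann G i j k l y =
     (\<Sum>m\<in>UNIV. G y $ i $ m *
       (partial_deriv k (christoffel G l j m) y - partial_deriv l (christoffel G k j m) y
        + (\<Sum>n\<in>UNIV. christoffel G k n m y * christoffel G l j n y
                    - christoffel G l n m y * christoffel G k j n y)))"

definition geodesic_on :: "(real^4 \<Rightarrow> real^4^4) \<Rightarrow> real set \<Rightarrow> (real \<Rightarrow> real^4) \<Rightarrow> bool" where
  "geodesic_on G T x \<longleftrightarrow>
     (\<exists>x' x''. \<forall>t\<in>T.
        (x has_vector_derivative x' t) (at t within T) \<and>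
        (x' has_vector_derivative x'' t) (at t within T) \<and>
        (\<forall>k. x'' t $ k +
          (\<Sum>i\<in>UNIV. \<Sum>j\<in>UNIV. christoffel G i j k (x t) * x' t $ i * x' t $ j) = 0))"

text \<open>
  Riemannian normal coordinates centred at \<open>p\<close>: the coordinate frame at \<open>p\<close> is orthonormal and
  the coordinate map inverts the exponential map, that is, the point with coordinates \<open>v\<close> is
  reached at time 1 by the geodesic from \<open>p\<close> with initial velocity \<open>v\<close>.
\<close>
definition normal_chart :: "'m chart set \<Rightarrow> 'm metric \<Rightarrow> 'm \<Rightarrow> 'm chart \<Rightarrow> bool" where
  "normal_chart A g p c \<longleftrightarrow>
     c \<in> A \<and> p \<in> fst c \<and> snd c p = 0 \<and> g c p = mat 1 \<and>
     (\<forall>v\<in>snd c ` fst c. closed_segment 0 v \<subseteq> snd c ` fst c \<and>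
        geodesic_on (metric_coords g c) {0..1} (\<lambda>t. t *\<^sub>R v))"


section \<open>Clifford algebra\<close>

text \<open>
  Generators \<open>\<gamma>\<^sub>i\<close> of the Clifford algebra acting on a complex vector space of dimension 4.
\<close>
type_synonym gammas = "4 \<Rightarrow> complex^4^4"

definition clifford_gammas :: "gammas \<Rightarrow> bool" where
  "clifford_gammas \<gamma> \<longleftrightarrow>
     (\<forall>i j. \<gamma> i ** \<gamma> j + \<gamma> j ** \<gamma> i = mat (if i = j then - 2 else 0))"

definition clifford :: "gammas \<Rightarrow> real^4 \<Rightarrow> complex^4^4" where
  "clifford \<gamma> v = (\<Sum>i\<in>UNIV. v $ i *\<^sub>R \<gamma> i)"

text \<open>
  \<open>Spin(4)\<close>, as the group of products of evenly many unit vectors, in its (faithful) spinor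
  representation.
\<close>
inductive_set Spin4 :: "gammas \<Rightarrow> (complex^4^4) set" for \<gamma> :: gammas where
  Spin4_one: "mat 1 \<in> Spin4 \<gamma>"
| Spin4_step: "s \<in> Spin4 \<gamma> \<Longrightarrow> norm u = 1 \<Longrightarrow> norm v = 1 \<Longrightarrow>
    s ** clifford \<gamma> u ** clifford \<gamma> v \<in> Spin4 \<gamma>"

definition spin_gen :: "gammas \<Rightarrow> 4 \<Rightarrow> 4 \<Rightarrow> complex^4^4" where
  "spin_gen \<gamma> i j = (1/8) *\<^sub>R (\<gamma> i ** \<gamma> j - \<gamma> j ** \<gamma> i)"

definition grading :: "gammas \<Rightarrow> complex^4^4" where
  "grading \<gamma> = mat (\<i>\<^sup>2) ** \<gamma> 1 ** \<gamma> 2 ** \<gamma> 3 ** \<gamma> 4"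

definition supertrace :: "gammas \<Rightarrow> complex^4^4 \<Rightarrow> complex" where
  "supertrace \<gamma> B = trace (grading \<gamma> ** B)"


section \<open>Spin structures and the spinor bundle\<close>

text \<open>
  A framed chart \<open>(c, E)\<close> is a chart with an oriented orthonormal frame field on its domain; the
  \<open>a\<close>-th frame vector at \<open>p\<close> has the \<open>a\<close>-th column of \<open>E p\<close> as components with respect to \<open>c\<close>.
\<close>
type_synonym 'm framed_chart = "'m chart \<times> ('m \<Rightarrow> real^4^4)"

abbreviation frame_dom :: "'m framed_chart \<Rightarrow> 'm set" where
  "frame_dom f \<equiv> fst (fst f)"

definition oriented_orthonormal_frame ::
    "'m chart set \<Rightarrow> 'm metric \<Rightarrow> 'm framed_chart \<Rightarrow> bool" where
  "oriented_orthonormal_frame A g f \<longleftrightarrow>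
     fst f \<in> A \<and>
     smooth_on (snd (fst f) ` frame_dom f) (\<lambda>y. snd f (chart_inv (fst f) y)) \<and>
     (\<forall>p\<in>frame_dom f.
        transpose (snd f p) ** g (fst f) p ** snd f p = mat 1 \<and> det (snd f p) > 0)"

text \<open>
  Components with respect to the frame \<open>f\<close> of a tangent vector \<open>v\<close> at \<open>p\<close>, itself given by its
  components with respect to the chart \<open>c\<close>.
\<close>
definition frame_components ::
    "'m framed_chart \<Rightarrow> 'm \<Rightarrow> 'm chart \<Rightarrow> real^4 \<Rightarrow> real^4" where
  "frame_components f p c v = matrix_inv (snd f p) *v (transition_jac c (fst f) p *v v)"

definition frame_change :: "'m framed_chart \<Rightarrow> 'm framed_chart \<Rightarrow> 'm \<Rightarrow> real^4^4" where
  "frame_change f f' p =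
     matrix_inv (snd f' p) ** transition_jac (fst f) (fst f') p ** snd f p"

text \<open>
  The spin structure is a lift to \<open>Spin(4)\<close> of the \<open>SO(4)\<close>-valued transition functions
  \<open>frame_change\<close> of the oriented orthonormal frame bundle, with respect to a covering family
  \<open>F\<close> of framed charts. Over the domain of each \<open>f \<in> F\<close> the spinor bundle \<open>S\<close> is trivialised
  with fibre \<^typ>\<open>complex^4\<close>, and \<open>s f f' p\<close> maps the trivialisation \<open>f\<close> to the
  trivialisation \<open>f'\<close>. The matrices \<open>\<gamma>0\<close> are the Clifford action of the standard basis on
  this fibre.
\<close>
locale closed_riemannian_spin_4manifold = closed_riemannian_4manifold X A g
  for X :: "'m topology" and A :: "'m chart set" and g :: "'m metric" +
  fixes \<gamma>0 :: gammas
    and F :: "'m framed_chart set"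
    and s :: "'m framed_chart \<Rightarrow> 'm framed_chart \<Rightarrow> 'm \<Rightarrow> complex^4^4"
  assumes gammas: "clifford_gammas \<gamma>0"
    and frames: "\<And>f. f \<in> F \<Longrightarrow> oriented_orthonormal_frame A g f"
    and frames_cover: "(\<Union>f\<in>F. frame_dom f) = topspace X"
    and lift_continuous: "\<And>f f'. f \<in> F \<Longrightarrow> f' \<in> F \<Longrightarrow>
      continuous_map (subtopology X (frame_dom f \<inter> frame_dom f')) euclidean (s f f')"
    and lift_spin: "\<And>f f' p. f \<in> F \<Longrightarrow> f' \<in> F \<Longrightarrow> p \<in> frame_dom f \<inter> frame_dom f' \<Longrightarrow>
      s f f' p \<in> Spin4 \<gamma>0"
    and lift_covers: "\<And>f f' p w. f \<in> F \<Longrightarrow> f' \<in> F \<Longrightarrow> p \<in> frame_dom f \<inter> frame_dom f' \<Longrightarrow>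
      s f f' p ** clifford \<gamma>0 w = clifford \<gamma>0 (frame_change f f' p *v w) ** s f f' p"
    and lift_cocycle: "\<And>f f' f'' p. f \<in> F \<Longrightarrow> f' \<in> F \<Longrightarrow> f'' \<in> F \<Longrightarrow>
      p \<in> frame_dom f \<inter> frame_dom f' \<inter> frame_dom f'' \<Longrightarrow>
      s f' f'' p ** s f f' p = s f f'' p"

text \<open>
  Clifford multiplication \<open>c(e\<^sub>i)\<close> on the spinor space at \<open>p\<close> by the \<open>i\<close>-th coordinate vector
  of the chart \<open>c\<close>, as a matrix in the trivialisation of the spinor bundle given by \<open>f\<close>.
\<close>
definition coord_gammas ::
    "gammas \<Rightarrow> 'm framed_chart \<Rightarrow> 'm \<Rightarrow> 'm chart \<Rightarrow> gammas" where
  "coord_gammas \<gamma>0 f p c i = clifford \<gamma>0 (frame_components f p c (axis i 1))"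


section \<open>The super residue density\<close>

text \<open>
  Surface measure on the unit sphere, obtained from polar coordinates: the area of a Borel set
  \<open>B\<close> of directions is \<open>DIM\<close> times the volume of the cone over \<open>B\<close> in the unit ball.
\<close>
definition sphere_measure :: "'a::euclidean_space measure" where
  "sphere_measure =
     distr (density lborel (\<lambda>x. ennreal (real DIM('a)) * indicator (ball 0 1) x)) borel
       (\<lambda>x. x /\<^sub>R norm x)"

text \<open>
  \<open>B \<xi>\<close> is the symbol at the point under consideration, as an endomorphism of the spinor space
  on which the \<open>\<gamma>\<^sub>i\<close> act.
\<close>
definition sres :: "gammas \<Rightarrow> (real^4 \<Rightarrow> complex^4^4) \<Rightarrow> complex" where
  "sres \<gamma> B =
     complex_of_real (1 / (2 * pi)^4) * (LINT \<xi>|sphere_measure. supertrace \<gamma> (B \<xi>))"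


section \<open>Exterior forms at a point\<close>

text \<open>
  A \<open>k\<close>-form is a function of the vectors \<open>v 0, \<dots>, v (k - 1)\<close>; the other entries of \<open>v\<close> are
  ignored.
\<close>
type_synonym 'n ext_form = "(nat \<Rightarrow> real^'n) \<Rightarrow> real"

definition wedge :: "nat \<Rightarrow> nat \<Rightarrow> 'n::finite ext_form \<Rightarrow> 'n ext_form \<Rightarrow> 'n ext_form" where
  "wedge k l \<alpha> \<beta> v =
     1 / (fact k * fact l) *
     (\<Sum>\<pi> | \<pi> permutes {..<k+l}.
        of_int (sign \<pi>) * \<alpha> (\<lambda>i. v (\<pi> i)) * \<beta> (\<lambda>i. v (\<pi> (k + i))))"

definition coord_form :: "'n::finite \<Rightarrow> 'n ext_form" where
  "coord_form i v = v 0 $ i"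

definition coord_volume :: "4 ext_form" where
  "coord_volume =
     wedge 1 3 (coord_form 1) (wedge 1 2 (coord_form 2)
       (wedge 1 1 (coord_form 3) (coord_form 4)))"

definition curvature_form ::
    "(real^4 \<Rightarrow> real^4^4) \<Rightarrow> 4 \<Rightarrow> 4 \<Rightarrow> real^4 \<Rightarrow> 4 ext_form" where
  "curvature_form G i j y v =
     1/2 * (\<Sum>k\<in>UNIV. \<Sum>l\<in>UNIV.
       riemann G i j k l y * wedge 1 1 (coord_form k) (coord_form l) v)"

text \<open>
  Both indices of \<open>R\<^sub>i\<^sub>j\<close> are lowered, so this is the trace of \<open>R \<and> R\<close> only where
  the coordinate frame is orthonormal, in particular at the centre of normal coordinates.
\<close>
definition trace_R_wedge_R :: "(real^4 \<Rightarrow> real^4^4) \<Rightarrow> real^4 \<Rightarrow> 4 ext_form" where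
  "trace_R_wedge_R G y v =
     (\<Sum>i\<in>UNIV. \<Sum>j\<in>UNIV. wedge 2 2 (curvature_form G i j y) (curvature_form G j i y) v)"

end

theory Submission
  imports Defs
begin

text \<open>
  Put \<open>D a i j k = \<partial>\<^sub>a \<Gamma>\<^sub>i\<^sub>j\<^sup>k\<close> at the centre. The supertrace of a product
  \<open>\<gamma>\<^sub>k \<gamma>\<^sub>j \<gamma>\<^sub>n \<gamma>\<^sub>m\<close> vanishes unless all four indices are
  different: if \<open>i\<close> is not among them, then \<open>\<gamma>\<^sub>i\<close> commutes with the product and anticommutes
  with the grading. Hence \<open>str(\<sigma>\<^sub>k\<^sub>j \<sigma>\<^sub>n\<^sub>m)\<close> is a multiple of the Levi-Civita
  symbol (\<open>alternating4_supertrace\<close>), and so is the value of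
  \<open>dx\<^sup>k \<and> dx\<^sup>j \<and> dx\<^sup>n \<and> dx\<^sup>m\<close> on any four vectors (\<open>alternating4_volume4\<close>).
  Two such arrays are proportional (\<open>alternating4_proportional\<close>), so multiplying the supertrace
  by the volume form turns it into a four-form, with factor \<open>- 4 / 16 = - 1 / 4\<close>.

  An alternating array sees only the part of \<open>D a i j k\<close> that is antisymmetric in \<open>j\<close> and \<open>k\<close>, and
  in normal coordinates this part is half of the curvature:
  \<open>D a i j k - D a i k j = R a i k j\<close> (\<open>D\<Gamma>_antisym\<close>). To see this, let
  \<open>H a b i j = \<partial>\<^sub>a \<partial>\<^sub>b g\<^sub>i\<^sub>j\<close> at the centre. The rays \<open>t v\<close> are geodesics, so
  \<open>\<Gamma>\<^sub>i\<^sub>j\<^sup>k(t v) v\<^sup>i v\<^sup>j = 0\<close>. At \<open>t = 0\<close> this gives \<open>\<Gamma> = 0\<close> and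
  \<open>\<partial>g = 0\<close> at the centre; its first derivative in \<open>t\<close> gives
  \<open>D a i j k + D i j a k + D j a i k = 0\<close>. Since \<open>D\<close> and \<open>R\<close> are
  now both linear in \<open>H\<close>, and \<open>H\<close> is symmetric in its first and in its last two indices, the
  relation between \<open>D\<close> and \<open>R\<close> is a linear combination of two of these cyclic identities.
  Contracting \<open>R a i k j R a i n m\<close> with the four-form yields \<open>- 4 tr(R \<and> R)\<close>, because \<open>R\<close>
  is antisymmetric in its first two indices.

  It remains to integrate over the unit sphere, where \<open>|\<xi>| = 1\<close>. The integral of \<open>1\<close> is
  \<open>2 \<pi>\<^sup>2\<close>, and by reflections and permutations of the coordinates the integral of
  \<open>\<xi>\<^sub>a \<xi>\<^sub>b\<close> is a quarter of this for \<open>a = b\<close> and zero otherwise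
  (\<open>integral_sphere_mult\<close>). So the second residue reduces to the first one with a factor
  \<open>1 / 4\<close>, and in both cases the constant follows from
  \<open>2 \<pi>\<^sup>2 / (2 \<pi>)\<^sup>4 / 4 = 1 / (32 \<pi>\<^sup>2)\<close>.
\<close>


section \<open>The round three-sphere\<close>

lemma ball_unit_measurable [measurable]: "ball (0::'a::euclidean_space) 1 \<in> sets borel"
  by simp

text \<open>
  It is enough to compare boxes, and orthogonal maps preserve the Lebesgue measure of boxes.
\<close>
lemma distr_lborel_orthogonal:
  fixes T :: "real^'n::{finite,wellorder} \<Rightarrow> real^'n::_"
  assumes "orthogonal_transformation T"
  shows "distr lborel borel T = lborel"
proof (rule lborel_eqI[symmetric])
  have inv: "orthogonal_transformation (inv T)"
    by (rule orthogonal_transformation_inv) fact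
  have T [measurable]: "T \<in> borel \<rightarrow>\<^sub>M borel"
    using assms by (intro borel_measurable_continuous_onI linear_continuous_on)
      (simp add: orthogonal_transformation_linear linear_conv_bounded_linear[symmetric])
  fix l u :: "real^'n::_" assume le: "\<And>b. b \<in> Basis \<Longrightarrow> l \<bullet> b \<le> u \<bullet> b"
  have "emeasure (distr lborel borel T) (box l u) = emeasure lborel (T -` box l u)"
    by (simp add: emeasure_distr)
  also have "T -` box l u = inv T ` box l u"
    using orthogonal_transformation_bij[OF assms] by (simp add: bij_vimage_eq_inv_image)
  also have "emeasure lborel (inv T ` box l u) = emeasure lebesgue (inv T ` box l u)"
  proof -
    have "inv T ` box l u = T -` box l u \<inter> space borel"
      using orthogonal_transformation_bij[OF assms] by (simp add: bij_vimage_eq_inv_image)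
    also have "\<dots> \<in> sets borel" by measurable
    finally show ?thesis by (simp add: emeasure_completion)
  qed
  also have "\<dots> = ennreal (measure lebesgue (inv T ` box l u))"
    by (rule emeasure_eq_measure2, rule measurable_orthogonal_image[OF inv]) simp
  also have "measure lebesgue (inv T ` box l u) = measure lebesgue (box l u)"
    by (rule measure_orthogonal_image[OF inv]) simp
  also have "\<dots> = (\<Prod>b\<in>Basis. (u - l) \<bullet> b)"
    using le by (simp add: measure_lborel_box_eq)
  finally show "emeasure (distr lborel borel T) (box l u) = (\<Prod>b\<in>Basis. (u - l) \<bullet> b)" .
qed simp

lemma integral_sphere_measure:
  fixes f :: "'a::euclidean_space \<Rightarrow> 'b::{banach,second_countable_topology}"
  assumes [measurable]: "f \<in> borel_measurable borel"
  shows "(LINT \<xi>|sphere_measure. f \<xi>)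
    = (LINT x|lborel. (real DIM('a) * indicator (ball 0 1) x) *\<^sub>R f (x /\<^sub>R norm x))"
proof -
  have "(\<lambda>x::'a. ennreal (real DIM('a)) * indicator (ball 0 1) x)
      = (\<lambda>x. ennreal (real DIM('a) * indicator (ball 0 1) x))"
    by (simp add: fun_eq_iff ennreal_mult' ennreal_indicator)
  moreover have "(\<lambda>x::'a. real DIM('a) * indicat_real (ball 0 1) x) \<in> borel_measurable borel"
    by (intro borel_measurable_times borel_measurable_indicator borel_measurable_const) simp
  ultimately show ?thesis
    unfolding sphere_measure_def by (simp add: integral_distr integral_density)
qed

lemma integral_sphere_measure_orthogonal:
  fixes T :: "real^'n::{finite,wellorder} \<Rightarrow> real^'n::_"
    and f :: "real^'n::_ \<Rightarrow> 'b::{banach,second_countable_topology}"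
  assumes T: "orthogonal_transformation T" and [measurable]: "f \<in> borel_measurable borel"
  shows "(LINT \<xi>|sphere_measure. f (T \<xi>)) = (LINT \<xi>|sphere_measure. f \<xi>)"
proof -
  have [measurable]: "T \<in> borel \<rightarrow>\<^sub>M borel"
    using T by (intro borel_measurable_continuous_onI linear_continuous_on)
      (simp add: orthogonal_transformation_linear linear_conv_bounded_linear[symmetric])
  have "(LINT \<xi>|sphere_measure. f \<xi>)
      = (LINT x|distr lborel borel T. (real CARD('n) * indicator (ball 0 1) x) *\<^sub>R f (x /\<^sub>R norm x))"
    unfolding distr_lborel_orthogonal[OF T] by (simp add: integral_sphere_measure)
  also have "\<dots> = (LINT x|lborel. (real CARD('n) * indicator (ball 0 1) (T x)) *\<^sub>R f (T x /\<^sub>R norm (T x)))"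
    by (subst integral_distr) simp_all
  also have "\<dots> = (LINT x|lborel. (real CARD('n) * indicator (ball 0 1) x) *\<^sub>R f (T (x /\<^sub>R norm x)))"
    using T by (simp add: orthogonal_transformation_norm orthogonal_transformation_scaleR indicator_def)
  also have "\<dots> = (LINT \<xi>|sphere_measure. f (T \<xi>))"
    by (simp add: integral_sphere_measure)
  finally show ?thesis ..
qed

lemma AE_sphere_measure_norm: "AE \<xi> in (sphere_measure::'a::euclidean_space measure). norm \<xi> = 1"
proof -
  have "AE x in (lborel::'a measure). x \<noteq> 0"
    by (rule AE_lborel_singleton)
  then show ?thesis
    unfolding sphere_measure_def by (subst AE_distr_iff) (simp_all add: AE_density del: mem_ball mem_ball_0, elim eventually_mono, simp)
qed

lemma emeasure_sphere_measure:
  "emeasure (sphere_measure::(real^4) measure) UNIV = ennreal (2 * pi\<^sup>2)"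
proof -
  have "emeasure (sphere_measure::(real^4) measure) UNIV
      = (\<integral>\<^sup>+x. ennreal 4 * indicator (ball 0 1) (x::real^4) \<partial>lborel)"
    unfolding sphere_measure_def
    by (subst emeasure_distr) (simp_all add: emeasure_density del: mem_ball)
  also have "\<dots> = ennreal 4 * emeasure lborel (ball (0::real^4) 1)"
    by (subst nn_integral_cmult) simp_all
  also have "\<dots> = ennreal (2 * pi\<^sup>2)"
    by (simp add: emeasure_ball eval_unit_ball_vol ennreal_mult'[symmetric] fact_numeral flip: ennreal_numeral)
  finally show ?thesis .
qed

lemma space_sphere_measure [simp]: "space sphere_measure = UNIV"
  and sets_sphere_measure [measurable_cong, simp]: "sets sphere_measure = sets borel"
  by (simp_all add: sphere_measure_def)

lemma measure_sphere_measure: "measure (sphere_measure::(real^4) measure) UNIV = 2 * pi\<^sup>2"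
  by (simp add: measure_def emeasure_sphere_measure)

lemma finite_sphere_measure: "finite_measure (sphere_measure::(real^4) measure)"
  by (rule finite_measureI) (simp add: emeasure_sphere_measure)

lemma integrable_sphere_mult: "integrable (sphere_measure::(real^4) measure) (\<lambda>\<xi>. \<xi> $ a * \<xi> $ b)"
proof -
  interpret finite_measure "sphere_measure::(real^4) measure" by (rule finite_sphere_measure)
  show ?thesis
  proof (rule integrable_const_bound[where B=1])
    show "AE \<xi> in (sphere_measure::(real^4) measure). norm (\<xi> $ a * \<xi> $ b) \<le> 1"
      using AE_sphere_measure_norm
    proof (rule eventually_mono)
      fix \<xi> :: "real^4" assume "norm \<xi> = 1"
      then have "\<bar>\<xi> $ a\<bar> \<le> 1" "\<bar>\<xi> $ b\<bar> \<le> 1" using component_le_norm_cart[of \<xi>] by metis+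
      then show "norm (\<xi> $ a * \<xi> $ b) \<le> 1" by (simp add: abs_mult mult_le_one)
    qed
  qed simp
qed

text \<open>
  Reflecting the coordinate \<open>a\<close> changes the sign of the integrand if \<open>a \<noteq> b\<close>. Swapping two
  coordinates shows that the four integrals of squares agree, and on the sphere their integrands
  add up to \<open>1\<close>.
\<close>
lemma integral_sphere_mult:
  "(LINT \<xi>|(sphere_measure::(real^4) measure). \<xi> $ a * \<xi> $ b) = (if a = b then pi\<^sup>2 / 2 else 0)"
proof (cases "a = b")
  case False
  define T :: "real^4 \<Rightarrow> real^4" where "T = (\<lambda>x. \<chi> i. if i = a then - x $ i else x $ i)"
  have "orthogonal_transformation T"
    unfolding orthogonal_transformation_def T_def
    by (auto intro!: linearI simp: vec_eq_iff inner_vec_def intro!: sum.cong)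
  from integral_sphere_measure_orthogonal[OF this, of "\<lambda>\<xi>. \<xi> $ a * \<xi> $ b"] False
  show ?thesis by (simp add: T_def)
next
  case True
  have eq: "(LINT \<xi>|(sphere_measure::(real^4) measure). \<xi> $ i * \<xi> $ i)
    = (LINT \<xi>|(sphere_measure::(real^4) measure). \<xi> $ a * \<xi> $ a)" for i
  proof -
    define T :: "real^4 \<Rightarrow> real^4" where "T = (\<lambda>x. \<chi> j. x $ Transposition.transpose i a j)"
    have "(\<Sum>j\<in>UNIV. v $ Transposition.transpose i a j * w $ Transposition.transpose i a j)
        = (\<Sum>j\<in>UNIV. v $ j * w $ j)" for v w :: "real^4"
      by (rule sum.reindex_bij_betw[of "Transposition.transpose i a"]) (simp add: bij_betw_def)
    then have "orthogonal_transformation T"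
      unfolding orthogonal_transformation_def T_def
      by (auto intro!: linearI simp: vec_eq_iff inner_vec_def)
    from integral_sphere_measure_orthogonal[OF this, of "\<lambda>\<xi>. \<xi> $ a * \<xi> $ a"]
    show ?thesis by (simp add: T_def)
  qed
  have "4 * (LINT \<xi>|(sphere_measure::(real^4) measure). \<xi> $ a * \<xi> $ a)
     = (\<Sum>i\<in>UNIV. LINT \<xi>|(sphere_measure::(real^4) measure). \<xi> $ i * \<xi> $ i)"
    by (subst sum.cong[OF refl eq]) simp
  also have "\<dots> = (LINT \<xi>|(sphere_measure::(real^4) measure). (\<Sum>i\<in>UNIV. \<xi> $ i * \<xi> $ i))"
    by (rule Bochner_Integration.integral_sum[symmetric]) (rule integrable_sphere_mult)
  also have "\<dots> = (LINT \<xi>|(sphere_measure::(real^4) measure). 1)"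
  proof (rule integral_cong_AE)
    show "AE \<xi> in (sphere_measure::(real^4) measure). (\<Sum>i\<in>UNIV. \<xi> $ i * \<xi> $ i) = 1"
      using AE_sphere_measure_norm
    proof (rule eventually_mono)
      fix \<xi> :: "real^4" assume "norm \<xi> = 1"
      then have "\<xi> \<bullet> \<xi> = 1" by (simp only: norm_eq_1)
      then show "(\<Sum>i\<in>UNIV. \<xi> $ i * \<xi> $ i) = 1" by (simp only: inner_vec_def inner_real_def)
    qed
  qed measurable
  also have "\<dots> = 2 * pi\<^sup>2"
    by (simp add: measure_sphere_measure)
  finally show ?thesis using True by simp
qed


section \<open>Matrix algebra\<close>

lemma matrix_mul_uminus: 
  fixes A :: "'a::ring_1^'n^'m" and B :: "'a::ring_1^'p^'n"
  shows "(- A) ** B = - (A ** B)" "A ** (- B) = - (A ** B)"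
  by (simp_all add: matrix_matrix_mult_def vec_eq_iff sum_negf)

lemma matrix_mul_matrix_inv:
  fixes A :: "'a::semiring_1^'n^'m"
  assumes "invertible A"
  shows "A ** matrix_inv A = mat 1"
  using someI_ex[OF assms[unfolded invertible_def]] unfolding matrix_inv_def by blast


section \<open>Alternating arrays with four indices\<close>

definition alternating4 :: "(4 \<Rightarrow> 4 \<Rightarrow> 4 \<Rightarrow> 4 \<Rightarrow> 'a::ab_group_add) \<Rightarrow> bool" where
  "alternating4 F \<longleftrightarrow> (\<forall>k l m n. F l k m n = - F k l m n \<and> F k m l n = - F k l m n \<and> F k l n m = - F k l m n)"

text \<open>
  An alternating array is determined by its value at \<open>1, 2, 3, 4\<close>: sort the indices by adjacent
  transpositions, or find two equal ones. The products avoid a division by the value of either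
  array, which may vanish.
\<close>
lemma alternating4_proportional:
  fixes F H :: "4 \<Rightarrow> 4 \<Rightarrow> 4 \<Rightarrow> 4 \<Rightarrow> 'a::field_char_0"
  assumes "alternating4 F" "alternating4 H"
  shows "F k l m n * H 1 2 3 4 = F 1 2 3 4 * H k l m n"
proof -
  have zero: "F k k m n = 0" "F k m m n = 0" "F k l m m = 0" if "alternating4 F"
    for F :: "4 \<Rightarrow> 4 \<Rightarrow> 4 \<Rightarrow> 4 \<Rightarrow> 'a" and k l m n
  proof -
    have self_neg: "x = 0" if "x = - x" for x :: 'a
    proof -
      have "2 * x = 0" using that by (metis add.right_inverse mult_2)
      then show ?thesis by simp
    qed
    show "F k k m n = 0" "F k m m n = 0" "F k l m m = 0"
      by (rule self_neg, use that in \<open>unfold alternating4_def, blast\<close>)+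
  qed
  have swap: "F l k m n = - F k l m n" "F m l k n = - F m k l n" "F m n l k = - F m n k l" if "alternating4 F" 
    for F :: "4 \<Rightarrow> 4 \<Rightarrow> 4 \<Rightarrow> 4 \<Rightarrow> 'a" and k l m n
    using that unfolding alternating4_def by blast+
  note sw = swap[where l=2 and k=1] swap[where l=3 and k=1] swap[where l=4 and k=1]
    swap[where l=3 and k=2] swap[where l=4 and k=2] swap[where l=4 and k=3]
  show ?thesis
    using exhaust_4[of k] exhaust_4[of l] exhaust_4[of m] exhaust_4[of n]
    by (elim disjE; hypsubst) (simp_all only: sw[OF assms(1)] sw[OF assms(2)] zero[OF assms(1)] zero[OF assms(2)] mult_zero_left mult_zero_right mult_minus_left mult_minus_right minus_minus minus_zero)
qed

text \<open>
  Contraction with an antisymmetric array discards the symmetric part of the other factor.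
\<close>
lemma sum_mult_antisym:
  fixes P W :: "'n::finite \<Rightarrow> 'n \<Rightarrow> real"
  assumes "\<And>j k. W k j = - W j k"
  shows "(\<Sum>j\<in>UNIV. \<Sum>k\<in>UNIV. P j k * W j k) = 1/2 * (\<Sum>j\<in>UNIV. \<Sum>k\<in>UNIV. (P j k - P k j) * W j k)"
proof -
  have "(\<Sum>j\<in>UNIV. \<Sum>k\<in>UNIV. P k j * W j k) = (\<Sum>j\<in>UNIV. \<Sum>k\<in>UNIV. P j k * W k j)"
    by (rule sum.swap)
  also have "\<dots> = (\<Sum>j\<in>UNIV. \<Sum>k\<in>UNIV. - (P j k * W j k))"
    by (intro sum.cong refl) (metis assms mult_minus_right)
  finally show ?thesis
    by (simp add: left_diff_distrib sum_subtractf sum_negf)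
qed

lemma alternating4_swap:
  assumes "alternating4 F"
  shows "F l k m n = - F k l m n" "F k l n m = - F k l m n"
  using assms unfolding alternating4_def by blast+

text \<open>
  The order of the summation variables on the right is the one in which the curvature form
  \<open>R\<^sub>i\<^sub>j\<close> sums over its two form indices.
\<close>
lemma contract_alternating4:
  fixes V :: "4 \<Rightarrow> 4 \<Rightarrow> 4 \<Rightarrow> 4 \<Rightarrow> real"
  assumes V: "alternating4 V"
  shows "(\<Sum>j\<in>UNIV. \<Sum>k\<in>UNIV. \<Sum>m\<in>UNIV. \<Sum>n\<in>UNIV. P j k * P m n * V k j n m)
    = 1/4 * (\<Sum>k\<in>UNIV. \<Sum>j\<in>UNIV. \<Sum>n\<in>UNIV. \<Sum>m\<in>UNIV. (P j k - P k j) * (P m n - P n m) * V k j n m)"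
proof -
  let ?W = "\<lambda>j k. \<Sum>m\<in>UNIV. \<Sum>n\<in>UNIV. (P m n - P n m) * V k j n m"
  have inner: "(\<Sum>m\<in>UNIV. \<Sum>n\<in>UNIV. P m n * V k j n m) = 1/2 * ?W j k" for j k
    by (rule sum_mult_antisym) (rule alternating4_swap[OF V])
  have W: "?W k j = - ?W j k" for j k
    unfolding sum_negf[symmetric] by (intro sum.cong refl) (metis alternating4_swap(1)[OF V] mult_minus_right)
  have "(\<Sum>j\<in>UNIV. \<Sum>k\<in>UNIV. \<Sum>m\<in>UNIV. \<Sum>n\<in>UNIV. P j k * P m n * V k j n m)
      = (\<Sum>j\<in>UNIV. \<Sum>k\<in>UNIV. P j k * (1/2 * ?W j k))"
    unfolding inner[symmetric] by (simp only: sum_distrib_left mult.assoc)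
  also have "\<dots> = 1/2 * (\<Sum>j\<in>UNIV. \<Sum>k\<in>UNIV. (P j k - P k j) * (1/2 * ?W j k))"
    by (rule sum_mult_antisym) (subst W, simp)
  also have "\<dots> = 1/4 * (\<Sum>j\<in>UNIV. \<Sum>k\<in>UNIV. \<Sum>m\<in>UNIV. \<Sum>n\<in>UNIV. (P j k - P k j) * (P m n - P n m) * V k j n m)"
    by (simp add: sum_distrib_left mult.assoc)
  also have "\<dots> = 1/4 * (\<Sum>k\<in>UNIV. \<Sum>j\<in>UNIV. \<Sum>n\<in>UNIV. \<Sum>m\<in>UNIV. (P j k - P k j) * (P m n - P n m) * V k j n m)"
    by (subst sum.swap) (intro arg_cong2[where f="(*)"] sum.cong refl sum.swap)
  finally show ?thesis .
qed


section \<open>Clifford algebra and supertrace\<close>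

lemma clifford_square: "clifford_gammas \<gamma> \<Longrightarrow> \<gamma> i ** \<gamma> i = - mat 1"
  unfolding clifford_gammas_def
proof -
  assume "\<forall>i j. \<gamma> i ** \<gamma> j + \<gamma> j ** \<gamma> i = mat (if i = j then - 2 else 0)"
  from this[rule_format, of i i] have "2 *\<^sub>R (\<gamma> i ** \<gamma> i) = 2 *\<^sub>R (- mat 1)"
    by (simp add: scaleR_2 mat_def vec_eq_iff)
  then show ?thesis unfolding scaleR_cancel_left by simp
qed

lemma clifford_anticommute: "clifford_gammas \<gamma> \<Longrightarrow> i \<noteq> j \<Longrightarrow> \<gamma> i ** \<gamma> j = - (\<gamma> j ** \<gamma> i)"
  unfolding clifford_gammas_def eq_neg_iff_add_eq_0 by (auto simp: mat_def vec_eq_iff)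

text \<open>
  The Clifford relations in terms of vectors, which show that they are independent of the chosen
  orthonormal basis.
\<close>
lemma clifford_clifford:
  assumes "clifford_gammas \<gamma>"
  shows "clifford \<gamma> v ** clifford \<gamma> w + clifford \<gamma> w ** clifford \<gamma> v = mat (- 2 * complex_of_real (v \<bullet> w))"
proof -
  have mult: "clifford \<gamma> v ** clifford \<gamma> w = (\<Sum>i\<in>UNIV. \<Sum>j\<in>UNIV. (v $ i * w $ j) *\<^sub>R (\<gamma> i ** \<gamma> j))" for v w
    by (simp add: clifford_def vec_eq_iff matrix_matrix_mult_def sum_distrib_left sum_distrib_right sum_4 algebra_simps)
  have "clifford \<gamma> v ** clifford \<gamma> w + clifford \<gamma> w ** clifford \<gamma> v
      = (\<Sum>i\<in>UNIV. \<Sum>j\<in>UNIV. (v $ i * w $ j) *\<^sub>R (\<gamma> i ** \<gamma> j))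
      + (\<Sum>i\<in>UNIV. \<Sum>j\<in>UNIV. (v $ i * w $ j) *\<^sub>R (\<gamma> j ** \<gamma> i))"
    unfolding mult by (subst (2) sum.swap) (simp add: mult.commute)
  also have "\<dots> = (\<Sum>i\<in>UNIV. \<Sum>j\<in>UNIV. (v $ i * w $ j) *\<^sub>R (mat (if i = j then - 2 else 0) :: complex^4^4))"
    using assms unfolding clifford_gammas_def
    by (simp add: sum.distrib[symmetric] scaleR_add_right[symmetric])
  also have "\<dots> = mat (- 2 * complex_of_real (v \<bullet> w))"
    by (simp add: vec_eq_iff mat_def inner_vec_def sum_4 if_distrib algebra_simps scaleR_conv_of_real[where 'a=complex])
  finally show ?thesis .
qed

lemma grading_eq: "grading \<gamma> = - (\<gamma> 1 ** \<gamma> 2 ** \<gamma> 3 ** \<gamma> 4)"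
proof -
  have "mat (\<i>\<^sup>2) ** B = - B" for B :: "complex^4^4"
    by (simp add: vec_eq_iff matrix_matrix_mult_def mat_def if_distrib[of "\<lambda>z. z * _"] cong: if_cong)
  then show ?thesis by (simp add: grading_def matrix_mul_uminus)
qed

text \<open>
  Both identities follow by sorting the generators in a product with the anticommutation relations
  and cancelling squares.
\<close>
lemma
  assumes "clifford_gammas \<gamma>"
  shows grading_anticommute: "\<gamma> i ** grading \<gamma> = - (grading \<gamma> ** \<gamma> i)"
    and grading_square: "grading \<gamma> ** grading \<gamma> = mat 1"
proof -
  note ac = clifford_anticommute[OF assms] and sq = clifford_square[OF assms]
  have com: "\<gamma> 2 ** \<gamma> 1 = - (\<gamma> 1 ** \<gamma> 2)" "\<gamma> 3 ** \<gamma> 1 = - (\<gamma> 1 ** \<gamma> 3)" "\<gamma> 4 ** \<gamma> 1 = - (\<gamma> 1 ** \<gamma> 4)"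
    "\<gamma> 3 ** \<gamma> 2 = - (\<gamma> 2 ** \<gamma> 3)" "\<gamma> 4 ** \<gamma> 2 = - (\<gamma> 2 ** \<gamma> 4)" "\<gamma> 4 ** \<gamma> 3 = - (\<gamma> 3 ** \<gamma> 4)"
    by (rule ac, simp)+
  have com': "\<gamma> 2 ** (\<gamma> 1 ** B) = - (\<gamma> 1 ** (\<gamma> 2 ** B))" "\<gamma> 3 ** (\<gamma> 1 ** B) = - (\<gamma> 1 ** (\<gamma> 3 ** B))"
     "\<gamma> 4 ** (\<gamma> 1 ** B) = - (\<gamma> 1 ** (\<gamma> 4 ** B))" "\<gamma> 3 ** (\<gamma> 2 ** B) = - (\<gamma> 2 ** (\<gamma> 3 ** B))"
     "\<gamma> 4 ** (\<gamma> 2 ** B) = - (\<gamma> 2 ** (\<gamma> 4 ** B))" "\<gamma> 4 ** (\<gamma> 3 ** B) = - (\<gamma> 3 ** (\<gamma> 4 ** B))" for B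
    by (simp_all add: matrix_mul_assoc com matrix_mul_uminus)
  have sq': "\<gamma> i ** (\<gamma> i ** B) = - B" for i B
    by (simp add: matrix_mul_assoc sq matrix_mul_uminus)
  note rules = grading_eq matrix_mul_assoc[symmetric] com com' sq sq' matrix_mul_uminus
  show "\<gamma> i ** grading \<gamma> = - (grading \<gamma> ** \<gamma> i)"
    using exhaust_4[of i] by (elim disjE; hypsubst) (simp_all only: rules minus_minus matrix_mul_rid)
  show "grading \<gamma> ** grading \<gamma> = mat 1"
    by (simp only: rules minus_minus matrix_mul_rid)
qed

lemma supertrace_add: "supertrace \<gamma> (A + B) = supertrace \<gamma> A + supertrace \<gamma> B"
  by (simp add: supertrace_def matrix_add_ldistrib trace_add)

lemma supertrace_scaleR: "supertrace \<gamma> (c *\<^sub>R A) = c *\<^sub>R supertrace \<gamma> A"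
  by (simp add: supertrace_def trace_def matrix_matrix_mult_def scaleR_sum_right)

lemma linear_supertrace: "linear (supertrace \<gamma>)"
  by (rule linearI) (simp_all add: supertrace_add supertrace_scaleR)

text \<open>
  Insert \<open>\<gamma>\<^sub>i\<^sup>2 = - 1\<close> under the trace and move one of the two factors around the
  cycle: it passes \<open>B\<close> freely but picks up a sign at the grading, so the supertrace is its own
  negative.
\<close>
lemma supertrace_eq_0_if_commute:
  assumes "clifford_gammas \<gamma>" and commute: "\<gamma> i ** B = B ** \<gamma> i"
  shows "supertrace \<gamma> B = 0"
proof -
  have "supertrace \<gamma> B = - trace (grading \<gamma> ** B ** (\<gamma> i ** \<gamma> i))"
    by (simp add: supertrace_def clifford_square[OF assms(1)] matrix_mul_uminus)
       (simp add: trace_def sum_negf)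
  also have "grading \<gamma> ** B ** (\<gamma> i ** \<gamma> i) = (grading \<gamma> ** \<gamma> i) ** (B ** \<gamma> i)"
    by (simp add: matrix_mul_assoc[symmetric] commute[symmetric])
      (simp add: matrix_mul_assoc commute)
  also have "\<dots> = - (\<gamma> i ** (grading \<gamma> ** B ** \<gamma> i))"
    by (simp add: grading_anticommute[OF assms(1)] matrix_mul_assoc matrix_mul_uminus)
  also have "trace (- (\<gamma> i ** (grading \<gamma> ** B ** \<gamma> i))) = - trace ((grading \<gamma> ** B ** \<gamma> i) ** \<gamma> i)"
    by (subst trace_mul_sym[symmetric]) (simp add: trace_def sum_negf)
  also have "(grading \<gamma> ** B ** \<gamma> i) ** \<gamma> i = - (grading \<gamma> ** B)"
    by (simp add: matrix_mul_assoc[symmetric] clifford_square[OF assms(1)] matrix_mul_uminus)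
  finally have "supertrace \<gamma> B = - supertrace \<gamma> B"
    by (simp add: supertrace_def trace_def sum_negf)
  then show ?thesis by simp
qed

text \<open>
  For different indices, neighbouring generators anticommute. If an index is repeated, then some
  index is missing from the product, and its generator commutes with the product because it
  anticommutes with each of the four factors; hence the supertrace vanishes.
\<close>
lemma alternating4_supertrace:
  assumes cl: "clifford_gammas \<gamma>"
  shows "alternating4 (\<lambda>k l m n. supertrace \<gamma> (\<gamma> k ** \<gamma> l ** \<gamma> m ** \<gamma> n))" (is "alternating4 ?S")
proof -
  have zero: "?S k l m n = 0" if "i \<notin> {k, l, m, n}" for i k l m n
  proof (rule supertrace_eq_0_if_commute[OF cl])
    have *: "\<gamma> i ** \<gamma> k = - (\<gamma> k ** \<gamma> i)" "\<gamma> i ** \<gamma> l = - (\<gamma> l ** \<gamma> i)"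
      "\<gamma> i ** \<gamma> m = - (\<gamma> m ** \<gamma> i)" "\<gamma> i ** \<gamma> n = - (\<gamma> n ** \<gamma> i)"
      using that clifford_anticommute[OF cl] by auto
    have **: "\<gamma> i ** (\<gamma> k ** B) = - (\<gamma> k ** (\<gamma> i ** B))" "\<gamma> i ** (\<gamma> l ** B) = - (\<gamma> l ** (\<gamma> i ** B))"
      "\<gamma> i ** (\<gamma> m ** B) = - (\<gamma> m ** (\<gamma> i ** B))" for B
      by (simp_all add: matrix_mul_assoc * matrix_mul_uminus)
    show "\<gamma> i ** (\<gamma> k ** \<gamma> l ** \<gamma> m ** \<gamma> n) = \<gamma> k ** \<gamma> l ** \<gamma> m ** \<gamma> n ** \<gamma> i"
      by (simp only: matrix_mul_assoc[symmetric] * ** matrix_mul_uminus minus_minus)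
  qed
  have repeated: "?S k l m n = 0" if "\<not> distinct [k, l, m, n]" for k l m n
  proof -
    have "card (set [k, l, m, n]) < 4"
      using that card_length[of "[k,l,m,n]"] card_distinct[of "[k,l,m,n]"] by fastforce
    then have "{k, l, m, n} \<noteq> UNIV"
      using card_bit0 by (auto dest!: arg_cong[of _ _ card])
    then show ?thesis using zero by blast
  qed
  have neg: "supertrace \<gamma> (- B) = - supertrace \<gamma> B" for B
    by (rule linear_neg[OF linear_supertrace])
  have "?S l k m n = - ?S k l m n" "?S k m l n = - ?S k l m n" "?S k l n m = - ?S k l m n" for k l m n
  proof -
    show "?S l k m n = - ?S k l m n"
    proof (cases "k = l")
      case False
      show ?thesis by (simp only: clifford_anticommute[OF cl False] matrix_mul_uminus neg minus_minus)
    qed (simp add: repeated)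
    show "?S k m l n = - ?S k l m n"
    proof (cases "l = m")
      case False
      show ?thesis by (simp only: matrix_mul_assoc[symmetric, of "\<gamma> k"] clifford_anticommute[OF cl False] matrix_mul_uminus neg minus_minus)
    qed (simp add: repeated)
    show "?S k l n m = - ?S k l m n"
    proof (cases "m = n")
      case False
      show ?thesis by (simp only: matrix_mul_assoc[symmetric, of _ "\<gamma> m" "\<gamma> n"] matrix_mul_assoc[symmetric, of _ "\<gamma> n" "\<gamma> m"] clifford_anticommute[OF cl False] matrix_mul_uminus neg minus_minus)
    qed (simp add: repeated)
  qed
  then show ?thesis unfolding alternating4_def by blast
qed

lemma supertrace_volume:
  assumes cl: "clifford_gammas \<gamma>"
  shows "supertrace \<gamma> (\<gamma> 1 ** \<gamma> 2 ** \<gamma> 3 ** \<gamma> 4) = - 4"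
proof -
  have "\<gamma> 1 ** \<gamma> 2 ** \<gamma> 3 ** \<gamma> 4 = - grading \<gamma>" by (simp add: grading_eq)
  then have "supertrace \<gamma> (\<gamma> 1 ** \<gamma> 2 ** \<gamma> 3 ** \<gamma> 4) = trace (- mat 1 :: complex^4^4)"
    by (simp add: supertrace_def matrix_mul_uminus grading_square[OF cl])
  also have "\<dots> = - 4" by (simp add: trace_def mat_def)
  finally show ?thesis .
qed

lemma supertrace_spin_gen:
  assumes cl: "clifford_gammas \<gamma>"
  shows "supertrace \<gamma> (spin_gen \<gamma> k l ** spin_gen \<gamma> m n) = supertrace \<gamma> (\<gamma> k ** \<gamma> l ** \<gamma> m ** \<gamma> n) / 16"
proof -
  let ?S = "\<lambda>k l m n. supertrace \<gamma> (\<gamma> k ** \<gamma> l ** \<gamma> m ** \<gamma> n)"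
  have diff: "(A - B) ** C = A ** C - B ** C" "C ** (A - B) = C ** A - C ** B" for A B C :: "complex^4^4"
    by (simp_all add: matrix_matrix_mult_def vec_eq_iff algebra_simps sum_subtractf)
  have scale: "(c *\<^sub>R A) ** B = c *\<^sub>R (A ** B)" "A ** (c *\<^sub>R B) = c *\<^sub>R (A ** B)" for A B :: "complex^4^4" and c :: real
    by (simp_all add: matrix_matrix_mult_def vec_eq_iff scaleR_sum_right)
  have "spin_gen \<gamma> k l ** spin_gen \<gamma> m n = (1/64) *\<^sub>R
     (\<gamma> k ** \<gamma> l ** \<gamma> m ** \<gamma> n - \<gamma> k ** \<gamma> l ** \<gamma> n ** \<gamma> m - (\<gamma> l ** \<gamma> k ** \<gamma> m ** \<gamma> n - \<gamma> l ** \<gamma> k ** \<gamma> n ** \<gamma> m))"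
    by (simp add: spin_gen_def diff scale matrix_mul_assoc scaleR_right_diff_distrib)
  then have "supertrace \<gamma> (spin_gen \<gamma> k l ** spin_gen \<gamma> m n) = (1/64) *\<^sub>R
     (?S k l m n - ?S k l n m - (?S l k m n - ?S l k n m))"
    by (simp only: supertrace_scaleR linear_diff[OF linear_supertrace])
  moreover have "?S k l n m = - ?S k l m n" "?S l k m n = - ?S k l m n" "?S l k n m = ?S k l m n"
    using alternating4_supertrace[OF cl] unfolding alternating4_def by (metis minus_minus)+
  ultimately show ?thesis by (simp only: scaleR_conv_of_real) simp
qed

lemma clifford_gammas_orthonormal:
  assumes cl: "clifford_gammas \<gamma>" and "\<And>i j. w i \<bullet> w j = (if i = j then 1 else 0)"
  shows "clifford_gammas (\<lambda>i. clifford \<gamma> (w i))"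
  unfolding clifford_gammas_def by (simp add: clifford_clifford[OF cl] assms(2))

text \<open>
  At a point where the coordinate frame is orthonormal, the matrix that expresses it in another
  orthonormal frame is orthogonal, so the coordinate vectors again act by Clifford generators.
\<close>
lemma clifford_gammas_coord_gammas:
  assumes "clifford_gammas \<gamma>0" and E: "transpose (snd f p) ** g (fst f) p ** snd f p = mat 1"
    and change: "g c p = transpose (transition_jac c (fst f) p) ** g (fst f) p ** transition_jac c (fst f) p"
    and "g c p = mat 1"
  shows "clifford_gammas (coord_gammas \<gamma>0 f p c)"
proof -
  let ?E = "snd f p" and ?J = "transition_jac c (fst f) p" and ?g = "g (fst f) p"
  let ?W = "matrix_inv ?E ** ?J"
  have inv: "?E ** matrix_inv ?E = mat 1"
    by (rule matrix_mul_matrix_inv) (use E matrix_left_right_inverse in \<open>auto simp: invertible_def\<close>)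
  have "transpose ?W ** ?W = transpose ?W ** (transpose ?E ** ?g ** ?E) ** ?W"
    by (simp add: E)
  also have "\<dots> = transpose (?E ** ?W) ** ?g ** (?E ** ?W)"
    by (simp add: matrix_transpose_mul matrix_mul_assoc)
  also have "?E ** ?W = ?J"
    by (simp add: matrix_mul_assoc inv)
  finally have W: "transpose ?W ** ?W = mat 1"
    using change assms(4) by simp
  have "(?W *v axis i 1) \<bullet> (?W *v axis j 1) = (transpose ?W ** ?W) $ i $ j" for i j
    by (simp add: matrix_vector_mul_component matrix_matrix_mult_def transpose_def inner_vec_def
        matrix_vector_mult_basis column_def)
  with W have "(?W *v axis i 1) \<bullet> (?W *v axis j 1) = (if i = j then 1 else 0)" for i j
    by (simp add: mat_def)
  from clifford_gammas_orthonormal[OF assms(1) this] show ?thesis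
    by (simp add: coord_gammas_def[abs_def] frame_components_def matrix_vector_mul_assoc)
qed


section \<open>Super residues of rotationally simple symbols\<close>

lemma sres_inverse_norm:
  "sres \<gamma> (\<lambda>\<xi>. (1 / norm \<xi> ^ 4) *\<^sub>R B) = complex_of_real (1 / (8 * pi\<^sup>2)) * supertrace \<gamma> B"
proof -
  have "(LINT \<xi>|(sphere_measure::(real^4) measure). (1 / norm \<xi> ^ 4) *\<^sub>R supertrace \<gamma> B)
      = (LINT \<xi>|(sphere_measure::(real^4) measure). supertrace \<gamma> B)"
  proof (rule integral_cong_AE)
    show "AE \<xi> in (sphere_measure::(real^4) measure). (1 / norm \<xi> ^ 4) *\<^sub>R supertrace \<gamma> B = supertrace \<gamma> B"
      using AE_sphere_measure_norm by (rule eventually_mono) simp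
  qed measurable
  also have "\<dots> = (2 * pi\<^sup>2) *\<^sub>R supertrace \<gamma> B"
    by (simp add: measure_sphere_measure)
  finally have "sres \<gamma> (\<lambda>\<xi>. (1 / norm \<xi> ^ 4) *\<^sub>R B)
      = complex_of_real (1 / (2 * pi) ^ 4 * (2 * pi\<^sup>2)) * supertrace \<gamma> B"
    unfolding sres_def supertrace_scaleR by (simp only: scaleR_conv_of_real of_real_mult mult.assoc)
  also have "1 / (2 * pi) ^ 4 * (2 * pi\<^sup>2) = 1 / (8 * pi\<^sup>2)"
    by (simp add: power_mult_distrib field_simps)
  finally show ?thesis .
qed

text \<open>
  On the unit sphere, averaging replaces \<open>\<xi>\<^sub>a \<xi>\<^sub>b\<close> by a quarter of the identity matrix; this is
  the origin of the factor \<open>1 / 4\<close> between the two residues.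
\<close>
lemma sres_quadratic:
  "sres \<gamma> (\<lambda>\<xi>. \<Sum>a\<in>UNIV. \<Sum>b\<in>UNIV. (\<xi> $ a * \<xi> $ b / norm \<xi> ^ 6) *\<^sub>R B a b)
    = complex_of_real (1 / (32 * pi\<^sup>2)) * supertrace \<gamma> (\<Sum>a\<in>UNIV. B a a)"
proof -
  let ?S = "sphere_measure :: (real^4) measure"
  have "(LINT \<xi>|?S. supertrace \<gamma> (\<Sum>a\<in>UNIV. \<Sum>b\<in>UNIV. (\<xi> $ a * \<xi> $ b / norm \<xi> ^ 6) *\<^sub>R B a b))
      = (LINT \<xi>|?S. (\<Sum>a\<in>UNIV. \<Sum>b\<in>UNIV. (\<xi> $ a * \<xi> $ b / norm \<xi> ^ 6) *\<^sub>R supertrace \<gamma> (B a b)))"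
    by (simp only: linear_sum[OF linear_supertrace] supertrace_scaleR)
  also have "\<dots> = (LINT \<xi>|?S. (\<Sum>a\<in>UNIV. \<Sum>b\<in>UNIV. (\<xi> $ a * \<xi> $ b) *\<^sub>R supertrace \<gamma> (B a b)))"
  proof (rule integral_cong_AE)
    show "AE \<xi> in ?S. (\<Sum>a\<in>UNIV. \<Sum>b\<in>UNIV. (\<xi> $ a * \<xi> $ b / norm \<xi> ^ 6) *\<^sub>R supertrace \<gamma> (B a b))
        = (\<Sum>a\<in>UNIV. \<Sum>b\<in>UNIV. (\<xi> $ a * \<xi> $ b) *\<^sub>R supertrace \<gamma> (B a b))"
      using AE_sphere_measure_norm by (rule eventually_mono) simp
  qed measurable
  also have "\<dots> = (\<Sum>a\<in>UNIV. \<Sum>b\<in>UNIV. (LINT \<xi>|?S. \<xi> $ a * \<xi> $ b) *\<^sub>R supertrace \<gamma> (B a b))"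
    by (simp add: integrable_sphere_mult)
  also have "\<dots> = (pi\<^sup>2 / 2) *\<^sub>R supertrace \<gamma> (\<Sum>a\<in>UNIV. B a a)"
    by (simp add: integral_sphere_mult linear_sum[OF linear_supertrace] scaleR_sum_right
        if_distrib[of "\<lambda>x. x *\<^sub>R _"] cong: if_cong)
  finally have "sres \<gamma> (\<lambda>\<xi>. \<Sum>a\<in>UNIV. \<Sum>b\<in>UNIV. (\<xi> $ a * \<xi> $ b / norm \<xi> ^ 6) *\<^sub>R B a b)
      = complex_of_real (1 / (2 * pi) ^ 4 * (pi\<^sup>2 / 2)) * supertrace \<gamma> (\<Sum>a\<in>UNIV. B a a)"
    unfolding sres_def by (simp only: scaleR_conv_of_real of_real_mult mult.assoc)
  also have "1 / (2 * pi) ^ 4 * (pi\<^sup>2 / 2) = 1 / (32 * pi\<^sup>2)"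
    by (simp add: power_mult_distrib field_simps)
  finally show ?thesis .
qed


section \<open>The four-form of the curvature\<close>

lemma lessThan_insert: "{..<2::nat} = {0, 1}" "{..<3::nat} = {0, 1, 2}" "{..<4::nat} = {0, 1, 2, 3}"
  by auto

lemma sum_sign_permutes_2:
  fixes f :: "nat \<Rightarrow> nat \<Rightarrow> real"
  shows "(\<Sum>\<pi> | \<pi> permutes {..<2::nat}. of_int (sign \<pi>) * f (\<pi> 0) (\<pi> 1)) = f 0 1 - f 1 0"
  unfolding lessThan_insert
  by (simp add: sum_over_permutations_insert sign_compose sign_swap_id permutation_swap_id sign_id
      permutation_compose sign_id transpose_def)

lemma sum_sign_permutes_3:
  fixes f :: "nat \<Rightarrow> nat \<Rightarrow> nat \<Rightarrow> real"
  shows "(\<Sum>\<pi> | \<pi> permutes {..<3::nat}. of_int (sign \<pi>) * f (\<pi> 0) (\<pi> 1) (\<pi> 2))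
    = f 0 1 2 - f 0 2 1 - f 1 0 2 + f 1 2 0 + f 2 0 1 - f 2 1 0"
  unfolding lessThan_insert
  by (simp add: sum_over_permutations_insert sign_compose sign_swap_id permutation_swap_id sign_id
      permutation_compose sign_id transpose_def)

lemma sum_sign_permutes_4:
  fixes f :: "nat \<Rightarrow> nat \<Rightarrow> nat \<Rightarrow> nat \<Rightarrow> real"
  shows "(\<Sum>\<pi> | \<pi> permutes {..<4::nat}. of_int (sign \<pi>) * f (\<pi> 0) (\<pi> 1) (\<pi> 2) (\<pi> 3))
    = f 0 1 2 3 - f 0 1 3 2 - f 0 2 1 3 + f 0 2 3 1 + f 0 3 1 2 - f 0 3 2 1
    - f 1 0 2 3 + f 1 0 3 2 + f 1 2 0 3 - f 1 2 3 0 - f 1 3 0 2 + f 1 3 2 0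
    + f 2 0 1 3 - f 2 0 3 1 - f 2 1 0 3 + f 2 1 3 0 + f 2 3 0 1 - f 2 3 1 0
    - f 3 0 1 2 + f 3 0 2 1 + f 3 1 0 2 - f 3 1 2 0 - f 3 2 0 1 + f 3 2 1 0"
  unfolding lessThan_insert
  by (simp add: sum_over_permutations_insert sign_compose sign_swap_id permutation_swap_id sign_id
      permutation_compose sign_id transpose_def)

lemma wedge_1_1: "wedge 1 1 (coord_form k) (coord_form l) v = v 0 $ k * v 1 $ l - v 1 $ k * v 0 $ l"
  using sum_sign_permutes_2[of "\<lambda>a b. v a $ k * v b $ l"]
  by (simp add: wedge_def coord_form_def mult.assoc numeral_2_eq_2)

text \<open>
  The value of \<open>dx\<^sup>k \<and> dx\<^sup>l \<and> dx\<^sup>m \<and> dx\<^sup>n\<close> on the vectors \<open>v 0, v 1, v 2, v 3\<close>. As one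
  sum over all permutations it is visibly alternating in \<open>k, l, m, n\<close>, unlike an iterated wedge
  product.
\<close>
definition volume4 :: "(nat \<Rightarrow> real^4) \<Rightarrow> 4 \<Rightarrow> 4 \<Rightarrow> 4 \<Rightarrow> 4 \<Rightarrow> real" where
  "volume4 v k l m n =
     (\<Sum>\<pi> | \<pi> permutes {..<4}. of_int (sign \<pi>) * (v (\<pi> 0) $ k * v (\<pi> 1) $ l * v (\<pi> 2) $ m * v (\<pi> 3) $ n))"

lemma alternating4_volume4: "alternating4 (volume4 v)"
  unfolding alternating4_def volume4_def
    sum_sign_permutes_4[of "\<lambda>a b c d. v a $ _ * v b $ _ * v c $ _ * v d $ _"]
  by (simp add: algebra_simps)

lemma wedge_2_2_coord_forms:
  "wedge 2 2 (wedge 1 1 (coord_form k) (coord_form l)) (wedge 1 1 (coord_form m) (coord_form n)) v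
    = volume4 v k l m n"
proof -
  have "wedge 2 2 (wedge 1 1 (coord_form k) (coord_form l)) (wedge 1 1 (coord_form m) (coord_form n)) v
      = 1/4 * (\<Sum>\<pi> | \<pi> permutes {..<4}. of_int (sign \<pi>) *
         ((v (\<pi> 0) $ k * v (\<pi> 1) $ l - v (\<pi> 1) $ k * v (\<pi> 0) $ l)
        * (v (\<pi> 2) $ m * v (\<pi> 3) $ n - v (\<pi> 3) $ m * v (\<pi> 2) $ n)))"
    unfolding wedge_def[of 2 2] wedge_1_1 by (simp add: mult.assoc eval_nat_numeral)
  then show ?thesis
    unfolding volume4_def
     sum_sign_permutes_4[of "\<lambda>a b c d. v a $ _ * v b $ _ * v c $ _ * v d $ _"]
     sum_sign_permutes_4[of "\<lambda>a b c d. (v a $ k * v b $ l - v b $ k * v a $ l) * (v c $ m * v d $ n - v d $ m * v c $ n)"]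
    by (simp add: algebra_simps)
qed

lemma coord_volume_eq_volume4: "coord_volume v = volume4 v 1 2 3 4"
proof -
  have 3: "wedge 1 2 (coord_form 2) (wedge 1 1 (coord_form 3) (coord_form 4)) v
    = v 0 $ 2 * (v 1 $ 3 * v 2 $ 4 - v 2 $ 3 * v 1 $ 4)
    - v 1 $ 2 * (v 0 $ 3 * v 2 $ 4 - v 2 $ 3 * v 0 $ 4)
    + v 2 $ 2 * (v 0 $ 3 * v 1 $ 4 - v 1 $ 3 * v 0 $ 4)" for v :: "nat \<Rightarrow> real^4"
  proof -
    have "wedge 1 2 (coord_form 2) (wedge 1 1 (coord_form 3) (coord_form 4)) v
      = 1/2 * (\<Sum>\<pi> | \<pi> permutes {..<3}. of_int (sign \<pi>) *
        (v (\<pi> 0) $ 2 * (v (\<pi> 1) $ 3 * v (\<pi> 2) $ 4 - v (\<pi> 2) $ 3 * v (\<pi> 1) $ 4)))"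
      unfolding wedge_def[of 1 2] wedge_1_1 coord_form_def by (simp add: mult.assoc eval_nat_numeral)
    then show ?thesis
      unfolding sum_sign_permutes_3[of "\<lambda>a b c. v a $ 2 * (v b $ 3 * v c $ 4 - v c $ 3 * v b $ 4)"]
      by (simp add: algebra_simps)
  qed
  let ?f = "\<lambda>a b c d. v a $ 1 * (v b $ 2 * (v c $ 3 * v d $ 4 - v d $ 3 * v c $ 4)
    - v c $ 2 * (v b $ 3 * v d $ 4 - v d $ 3 * v b $ 4)
    + v d $ 2 * (v b $ 3 * v c $ 4 - v c $ 3 * v b $ 4))"
  have "coord_volume v = 1/6 * (\<Sum>\<pi> | \<pi> permutes {..<4}. of_int (sign \<pi>) * ?f (\<pi> 0) (\<pi> 1) (\<pi> 2) (\<pi> 3))"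
    unfolding coord_volume_def wedge_def[of 1 3] 3 coord_form_def
    by (simp add: mult.assoc eval_nat_numeral fact_numeral)
  then show ?thesis
    unfolding volume4_def
     sum_sign_permutes_4[of ?f] 
     sum_sign_permutes_4[of "\<lambda>a b c d. v a $ _ * v b $ _ * v c $ _ * v d $ _"]
    by (simp add: algebra_simps)
qed

lemma trace_R_wedge_R_eq:
  "trace_R_wedge_R G y v = (\<Sum>i\<in>UNIV. \<Sum>j\<in>UNIV. \<Sum>k\<in>UNIV. \<Sum>l\<in>UNIV. \<Sum>m\<in>UNIV. \<Sum>n\<in>UNIV.
     1/4 * (riemann G i j k l y * riemann G j i m n y) * volume4 v k l m n)"
proof -
  have prod: "(\<Sum>k\<in>UNIV. \<Sum>l\<in>UNIV. a k l) * (\<Sum>m\<in>UNIV. \<Sum>n\<in>UNIV. b m n)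
      = (\<Sum>k\<in>UNIV. \<Sum>l\<in>UNIV. \<Sum>m\<in>UNIV. \<Sum>n\<in>UNIV. a k l * b m n)" for a b :: "4 \<Rightarrow> 4 \<Rightarrow> real"
    by (simp only: sum_distrib_right) (simp only: sum_distrib_left)
  have "wedge 2 2 (curvature_form G i j y) (curvature_form G j i y) v
     = (\<Sum>k\<in>UNIV. \<Sum>l\<in>UNIV. \<Sum>m\<in>UNIV. \<Sum>n\<in>UNIV.
      1/4 * (riemann G i j k l y * riemann G j i m n y) * volume4 v k l m n)" (is "_ = ?rhs") for i j
  proof -
    let ?R = "riemann G" and ?w = "\<lambda>k l. wedge 1 1 (coord_form k) (coord_form l)"
    have "wedge 2 2 (curvature_form G i j y) (curvature_form G j i y) v = (\<Sum>\<pi> | \<pi> permutes {..<2+2}.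
        \<Sum>k\<in>UNIV. \<Sum>l\<in>UNIV. \<Sum>m\<in>UNIV. \<Sum>n\<in>UNIV. 1/4 * (?R i j k l y * ?R j i m n y) *
         (1/(fact 2 * fact 2) * (of_int (sign \<pi>) * ?w k l (\<lambda>i. v (\<pi> i)) * ?w m n (\<lambda>i. v (\<pi> (2 + i))))))"
      unfolding wedge_def[of 2 2] sum_distrib_left[of _ _ "{\<pi>. \<pi> permutes {..<2+2}}"]
    proof (intro sum.cong refl)
      fix \<pi> :: "nat \<Rightarrow> nat"
      let ?a = "\<lambda>k l. ?R i j k l y * ?w k l (\<lambda>i. v (\<pi> i))" and ?b = "\<lambda>m n. ?R j i m n y * ?w m n (\<lambda>i. v (\<pi> (2 + i)))"
      have "1/(fact 2 * fact 2) * (of_int (sign \<pi>) * curvature_form G i j y (\<lambda>i. v (\<pi> i))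
          * curvature_form G j i y (\<lambda>i. v (\<pi> (2 + i))))
        = 1/(fact 2 * fact 2) * of_int (sign \<pi>) * (1/4)
          * ((\<Sum>k\<in>UNIV. \<Sum>l\<in>UNIV. ?a k l) * (\<Sum>m\<in>UNIV. \<Sum>n\<in>UNIV. ?b m n))"
        by (simp only: curvature_form_def) simp
      also have "\<dots> = (\<Sum>k\<in>UNIV. \<Sum>l\<in>UNIV. \<Sum>m\<in>UNIV. \<Sum>n\<in>UNIV.
          1/(fact 2 * fact 2) * of_int (sign \<pi>) * (1/4) * (?a k l * ?b m n))"
        by (simp only: prod) (simp only: sum_distrib_left)
      finally show "1/(fact 2 * fact 2) * (of_int (sign \<pi>) * curvature_form G i j y (\<lambda>i. v (\<pi> i))
          * curvature_form G j i y (\<lambda>i. v (\<pi> (2 + i)))) = (\<Sum>k\<in>UNIV. \<Sum>l\<in>UNIV. \<Sum>m\<in>UNIV. \<Sum>n\<in>UNIV.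
          1/4 * (?R i j k l y * ?R j i m n y) *
         (1/(fact 2 * fact 2) * (of_int (sign \<pi>) * ?w k l (\<lambda>i. v (\<pi> i)) * ?w m n (\<lambda>i. v (\<pi> (2 + i))))))"
        by (simp only: mult.assoc mult.commute mult.left_commute)
    qed
    also have "\<dots> = (\<Sum>k\<in>UNIV. \<Sum>l\<in>UNIV. \<Sum>m\<in>UNIV. \<Sum>n\<in>UNIV. 1/4 * (?R i j k l y * ?R j i m n y) *
         wedge 2 2 (?w k l) (?w m n) v)"
      unfolding wedge_def[of 2 2] sum_distrib_left
      by (simp only: sum.swap[of _ _ "{\<pi>. \<pi> permutes {..<2+2}}"])
    finally show ?thesis by (simp only: wedge_2_2_coord_forms)
  qed
  then show ?thesis by (simp only: trace_R_wedge_R_def)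
qed


section \<open>Partial derivatives\<close>

lemma partial_deriv_has_derivative:
  assumes "(f has_derivative f') (at x)"
  shows "partial_deriv a f x = f' (axis a 1)"
proof -
  have "((\<lambda>t. f (x + t *\<^sub>R axis a 1)) has_derivative (\<lambda>t. f' (t *\<^sub>R axis a 1))) (at 0)"
    by (rule has_derivative_compose[where f="\<lambda>t. x + t *\<^sub>R axis a 1" and x=0]) (use assms in \<open>auto intro!: derivative_eq_intros\<close>)
  moreover have "f' (t *\<^sub>R axis a 1) = t *\<^sub>R f' (axis a 1)" for t
    using assms by (simp add: linear_cmul has_derivative_linear)
  ultimately show ?thesis
    unfolding partial_deriv_def by (intro vector_derivative_at) (simp add: has_vector_derivative_def)
qed

text \<open>
  Partial derivatives at a point determine the total derivative there once it is known to exist.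
\<close>
lemma has_derivative_partial_derivs:
  assumes "f differentiable (at x)"
  shows "(f has_derivative (\<lambda>v. \<Sum>a\<in>UNIV. v $ a *\<^sub>R partial_deriv a f x)) (at x)"
proof -
  obtain f' where f': "(f has_derivative f') (at x)"
    using assms by (auto simp: differentiable_def)
  have "f' v = (\<Sum>a\<in>UNIV. v $ a *\<^sub>R partial_deriv a f x)" for v
  proof -
    interpret linear f' using f' by (rule has_derivative_linear)
    have "v = (\<Sum>a\<in>UNIV. v $ a *\<^sub>R axis a 1)"
      by (simp add: vec_eq_iff axis_def if_distrib cong: if_cong)
    then have "f' v = f' (\<Sum>a\<in>UNIV. v $ a *\<^sub>R axis a 1)" by simp
    also have "\<dots> = (\<Sum>a\<in>UNIV. v $ a *\<^sub>R partial_deriv a f x)"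
      by (simp add: sum scale partial_deriv_has_derivative[OF f'])
    finally show ?thesis .
  qed
  then have "f' = (\<lambda>v. \<Sum>a\<in>UNIV. v $ a *\<^sub>R partial_deriv a f x)" by blast
  with f' show ?thesis by simp
qed

lemma partial_deriv_cong:
  assumes "open S" "x \<in> S" "\<And>y. y \<in> S \<Longrightarrow> f y = g y"
  shows "partial_deriv a f x = partial_deriv a g x"
proof -
  have "((\<lambda>t. x + t *\<^sub>R axis a 1) \<longlongrightarrow> x + 0 *\<^sub>R axis a 1) (nhds (0::real))"
    by (intro tendsto_intros filterlim_ident)
  then have "\<forall>\<^sub>F t in nhds 0. x + t *\<^sub>R axis a 1 \<in> S"
    using assms(1,2) by (intro topological_tendstoD) auto
  then have "\<forall>\<^sub>F t in nhds 0. f (x + t *\<^sub>R axis a 1) = g (x + t *\<^sub>R axis a 1)"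
    by eventually_elim (rule assms(3))
  then show ?thesis
    unfolding partial_deriv_def by (intro vector_derivative_cong_eq) auto
qed

lemma smooth_on_partial_deriv:
  assumes "smooth_on S f"
  shows "smooth_on S (partial_deriv a f)"
  unfolding smooth_on_def
proof (intro conjI allI)
  show "open S" using assms by (simp add: smooth_on_def)
  fix as
  have "foldr partial_deriv (as @ [a]) f differentiable_on S"
    using assms unfolding smooth_on_def by blast
  then show "foldr partial_deriv as (partial_deriv a f) differentiable_on S" by simp
qed

lemma smooth_on_differentiable:
  assumes "smooth_on S f" "x \<in> S"
  shows "f differentiable (at x)"
proof -
  have "foldr partial_deriv [] f differentiable_on S" "open S"
    using assms(1) unfolding smooth_on_def by blast+
  then show ?thesis using assms(2) by (simp add: differentiable_on_eq_differentiable_at)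
qed

lemma smooth_on_isCont: "smooth_on S f \<Longrightarrow> x \<in> S \<Longrightarrow> isCont f x"
  by (rule differentiable_imp_continuous_within) (rule smooth_on_differentiable)

text \<open>
  Iterated partial derivatives are taken componentwise on the open set, and a partial derivative
  depends only on the values nearby.
\<close>
lemma smooth_on_vec_nth:
  fixes f :: "real^'n::finite \<Rightarrow> 'b::real_normed_vector^'m::finite"
  assumes "smooth_on S f"
  shows "smooth_on S (\<lambda>y. f y $ i)"
  unfolding smooth_on_def
proof (intro conjI allI)
  show S: "open S" using assms by (simp add: smooth_on_def)
  have diff: "foldr partial_deriv as f differentiable (at y)" if "y \<in> S" for as y
    using assms S that unfolding smooth_on_def by (auto simp: differentiable_on_eq_differentiable_at)
  have eq: "\<forall>y\<in>S. foldr partial_deriv as (\<lambda>y. f y $ i) y = foldr partial_deriv as f y $ i" for as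
  proof (induction as)
    case (Cons a as)
    show ?case
    proof
      fix y assume y: "y \<in> S"
      let ?g = "foldr partial_deriv as f"
      obtain g' where g': "(?g has_derivative g') (at y)"
        using diff[OF y] by (auto simp: differentiable_def)
      then have "((\<lambda>z. ?g z $ i) has_derivative (\<lambda>v. g' v $ i)) (at y)"
        by (rule bounded_linear.has_derivative[OF bounded_linear_vec_nth])
      then have "partial_deriv a (\<lambda>z. ?g z $ i) y = partial_deriv a ?g y $ i"
        using g' by (simp add: partial_deriv_has_derivative)
      with partial_deriv_cong[OF S y, of "foldr partial_deriv as (\<lambda>y. f y $ i)" "\<lambda>z. ?g z $ i" a] Cons.IH
      show "foldr partial_deriv (a # as) (\<lambda>y. f y $ i) y = foldr partial_deriv (a # as) f y $ i"
        by simp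
    qed
  qed simp
  fix as
  show "foldr partial_deriv as (\<lambda>y. f y $ i) differentiable_on S"
    unfolding differentiable_on_eq_differentiable_at[OF S]
  proof
    fix y assume y: "y \<in> S"
    have "(\<lambda>z. foldr partial_deriv as f z $ i) differentiable (at y)"
      using diff[OF y, of as] bounded_linear.has_derivative[OF bounded_linear_vec_nth]
      unfolding differentiable_def by blast
    then show "foldr partial_deriv as (\<lambda>y. f y $ i) differentiable (at y)"
      using eq[of as] S y unfolding differentiable_def
      by (metis (no_types, lifting) has_derivative_transform_within_open)
  qed
qed

lemma has_real_derivative_along_axis:
  fixes f :: "real^'n::finite \<Rightarrow> real"
  assumes "f differentiable (at (y + t *\<^sub>R axis a 1))"
  shows "((\<lambda>t. f (y + t *\<^sub>R axis a 1)) has_real_derivative partial_deriv a f (y + t *\<^sub>R axis a 1)) (at t)"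
proof -
  obtain f' where f': "(f has_derivative f') (at (y + t *\<^sub>R axis a 1))"
    using assms by (auto simp: differentiable_def)
  have "((\<lambda>t. f (y + t *\<^sub>R axis a 1)) has_derivative (\<lambda>s. f' (s *\<^sub>R axis a 1))) (at t)"
    by (rule has_derivative_compose[where f="\<lambda>t. y + t *\<^sub>R axis a 1", OF _ f'])
       (auto intro!: derivative_eq_intros)
  moreover have "f' (s *\<^sub>R axis a 1) = partial_deriv a f (y + t *\<^sub>R axis a 1) * s" for s
    using f' by (simp add: linear_cmul has_derivative_linear partial_deriv_has_derivative[OF f'])
  ultimately show ?thesis
    by (simp add: has_field_derivative_def)
qed

text \<open>
  Apply the mean value theorem twice, first to
  \<open>s \<mapsto> f(x + h e\<^sub>b + s e\<^sub>a) - f(x + s e\<^sub>a)\<close> and then to the resulting difference of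
  values of \<open>\<partial>\<^sub>a f\<close>.
\<close>
lemma mixed_difference:
  fixes f :: "real^'n::finite \<Rightarrow> real"
  assumes f: "smooth_on S f" and ball: "ball x r \<subseteq> S" and h: "0 < h" "2 * h < r"
  shows "\<exists>z\<in>ball x r. f (x + h *\<^sub>R axis a 1 + h *\<^sub>R axis b 1) - f (x + h *\<^sub>R axis a 1)
     - f (x + h *\<^sub>R axis b 1) + f x = h\<^sup>2 * partial_deriv b (partial_deriv a f) z"
proof -
  have in_ball: "x + s *\<^sub>R axis a 1 + t *\<^sub>R axis b 1 \<in> ball x r" if "0 \<le> s" "s \<le> h" "0 \<le> t" "t \<le> h" for s t
  proof -
    have "norm (s *\<^sub>R axis a (1::real) + t *\<^sub>R axis b 1) \<le> s + t"
      using that norm_triangle_ineq[of "s *\<^sub>R axis a (1::real)" "t *\<^sub>R axis b 1"] by simp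
    moreover have "dist x (x + s *\<^sub>R axis a 1 + t *\<^sub>R axis b 1) = norm (s *\<^sub>R axis a (1::real) + t *\<^sub>R axis b 1)"
      unfolding add.assoc dist_norm by (simp add: norm_minus_commute add.commute)
    ultimately show ?thesis using that h unfolding mem_ball by linarith
  qed
  have diff: "f differentiable (at (x + s *\<^sub>R axis a 1 + t *\<^sub>R axis b 1))"
    "partial_deriv a f differentiable (at (x + s *\<^sub>R axis a 1 + t *\<^sub>R axis b 1))"
    if "0 \<le> s" "s \<le> h" "0 \<le> t" "t \<le> h" for s t
    using in_ball[OF that] ball f smooth_on_partial_deriv[OF f, of a] by (auto intro: smooth_on_differentiable)
  let ?\<phi> = "\<lambda>s. f ((x + h *\<^sub>R axis b 1) + s *\<^sub>R axis a 1) - f (x + s *\<^sub>R axis a 1)"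
  let ?\<phi>' = "\<lambda>s. partial_deriv a f ((x + h *\<^sub>R axis b 1) + s *\<^sub>R axis a 1) - partial_deriv a f (x + s *\<^sub>R axis a 1)"
  have "\<exists>s. 0 < s \<and> s < h \<and> ?\<phi> h - ?\<phi> 0 = (h - 0) * ?\<phi>' s"
  proof (rule MVT2[OF h(1)])
    fix s assume s: "0 \<le> s" "s \<le> h"
    show "(?\<phi> has_real_derivative ?\<phi>' s) (at s)"
      using diff(1)[OF s, of h] diff(1)[OF s, of 0] h
      by (intro DERIV_diff has_real_derivative_along_axis) (simp_all add: algebra_simps)
  qed
  then obtain s where s: "0 < s" "s < h" and 1: "?\<phi> h - ?\<phi> 0 = h * ?\<phi>' s" by auto
  let ?\<psi> = "\<lambda>t. partial_deriv a f ((x + s *\<^sub>R axis a 1) + t *\<^sub>R axis b 1)"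
  have "\<exists>t. 0 < t \<and> t < h \<and> ?\<psi> h - ?\<psi> 0
      = (h - 0) * partial_deriv b (partial_deriv a f) ((x + s *\<^sub>R axis a 1) + t *\<^sub>R axis b 1)"
    by (rule MVT2[OF h(1)]) (use s diff(2)[of s] in \<open>auto intro!: has_real_derivative_along_axis\<close>)
  then obtain t where t: "0 < t" "t < h"
    and 2: "?\<psi> h - ?\<psi> 0 = h * partial_deriv b (partial_deriv a f) ((x + s *\<^sub>R axis a 1) + t *\<^sub>R axis b 1)"
    by auto
  have swap: "x + h *\<^sub>R axis b 1 + s *\<^sub>R axis a 1 = x + s *\<^sub>R axis a 1 + h *\<^sub>R axis b 1" for s
    by (simp only: add.assoc add.commute[of "h *\<^sub>R axis b 1"])
  have regroup: "p - q - u + w = (p - q) - (u - w)" for p q u w :: real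
    by simp
  let ?z = "x + s *\<^sub>R axis a 1 + t *\<^sub>R axis b 1"
  have "f (x + h *\<^sub>R axis a 1 + h *\<^sub>R axis b 1) - f (x + h *\<^sub>R axis a 1)
     - f (x + h *\<^sub>R axis b 1) + f x = ?\<phi> h - ?\<phi> 0"
    unfolding swap[of h] scaleR_zero_left add_0_right by (rule regroup)
  also have "\<dots> = h * ?\<phi>' s" by (fact 1)
  also have "?\<phi>' s = ?\<psi> h - ?\<psi> 0"
    unfolding swap[of s] scaleR_zero_left add_0_right by (rule refl)
  also have "\<dots> = h * partial_deriv b (partial_deriv a f) ?z" by (fact 2)
  finally have "f (x + h *\<^sub>R axis a 1 + h *\<^sub>R axis b 1) - f (x + h *\<^sub>R axis a 1)
     - f (x + h *\<^sub>R axis b 1) + f x = h\<^sup>2 * partial_deriv b (partial_deriv a f) ?z"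
    by (simp only: power2_eq_square mult.assoc)
  moreover have "?z \<in> ball x r"
    using in_ball[of s t] s t by (simp only: less_imp_le)
  ultimately show ?thesis by blast
qed

text \<open>
  The second difference of \<open>mixed_difference\<close> is symmetric in the two directions. So each mixed
  derivative takes, arbitrarily close to \<open>x\<close>, a value that the other one takes close to \<open>x\<close>, and
  continuity gives equality at \<open>x\<close>.
\<close>
lemma partial_deriv_commute:
  fixes f :: "real^'n::finite \<Rightarrow> real"
  assumes f: "smooth_on S f" and "x \<in> S"
  shows "partial_deriv a (partial_deriv b f) x = partial_deriv b (partial_deriv a f) x"
proof (rule ccontr)
  let ?F = "partial_deriv b (partial_deriv a f)" and ?G = "partial_deriv a (partial_deriv b f)"
  assume "?G x \<noteq> ?F x"
  define e where "e = \<bar>?G x - ?F x\<bar> / 2"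
  have e: "e > 0" using \<open>?G x \<noteq> ?F x\<close> by (simp add: e_def)
  have cont: "isCont ?F x" "isCont ?G x"
    using assms by (auto intro!: smooth_on_isCont smooth_on_partial_deriv)
  obtain d1 where d1: "d1 > 0" "\<And>y. dist y x < d1 \<Longrightarrow> dist (?F y) (?F x) < e"
    using cont(1) e unfolding continuous_at_eps_delta by metis
  obtain d2 where d2: "d2 > 0" "\<And>y. dist y x < d2 \<Longrightarrow> dist (?G y) (?G x) < e"
    using cont(2) e unfolding continuous_at_eps_delta by metis
  obtain d3 where d3: "d3 > 0" "ball x d3 \<subseteq> S"
    using f assms(2) unfolding smooth_on_def by (meson openE)
  define r where "r = min d1 (min d2 d3)"
  have r: "r > 0" "ball x r \<subseteq> S" using d1(1) d2(1) d3 by (auto simp: r_def)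
  define h where "h = r / 3"
  have h: "0 < h" "2 * h < r" using r(1) by (simp_all add: h_def)
  obtain y where y: "y \<in> ball x r" and 1: "f (x + h *\<^sub>R axis a 1 + h *\<^sub>R axis b 1) - f (x + h *\<^sub>R axis a 1)
     - f (x + h *\<^sub>R axis b 1) + f x = h\<^sup>2 * ?F y"
    using mixed_difference[OF f r(2) h, of a b] by blast
  obtain z where z: "z \<in> ball x r" and 2: "f (x + h *\<^sub>R axis b 1 + h *\<^sub>R axis a 1) - f (x + h *\<^sub>R axis b 1)
     - f (x + h *\<^sub>R axis a 1) + f x = h\<^sup>2 * ?G z"
    using mixed_difference[OF f r(2) h, of b a] by blast
  have swap: "x + h *\<^sub>R axis b 1 + h *\<^sub>R axis a 1 = x + h *\<^sub>R axis a 1 + h *\<^sub>R axis b 1"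
    by (simp only: ac_simps)
  have "h\<^sup>2 * ?F y = h\<^sup>2 * ?G z" using 1 2 unfolding swap by linarith
  then have "?F y = ?G z" using h by simp
  then have "dist (?G x) (?F x) \<le> dist (?G z) (?G x) + dist (?F y) (?F x)"
    by (metis dist_commute dist_triangle)
  also have "\<dots> < e + e"
    by (rule add_strict_mono) (use y z d1(2)[of y] d2(2)[of z] in \<open>auto simp: r_def dist_commute\<close>)
  finally show False by (simp add: e_def dist_real_def)
qed

lemma tendsto_det:
  fixes A :: "'a \<Rightarrow> 'b::{real_normed_field}^'n^'n"
  assumes "\<And>i j. ((\<lambda>y. A y $ i $ j) \<longlongrightarrow> M $ i $ j) F"
  shows "((\<lambda>y. det (A y)) \<longlongrightarrow> det M) F"
  unfolding det_def by (intro tendsto_intros assms)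

lemma matrix_inv_cramer:
  fixes A :: "'a::field^'n^'n"
  assumes "det A \<noteq> 0"
  shows "matrix_inv A $ k $ l = det (\<chi> i j. if j = k then axis l 1 $ i else A $ i $ j) / det A"
proof -
  have "A ** matrix_inv A = mat 1"
    using assms by (simp add: matrix_mul_matrix_inv invertible_det_nz)
  then have "A *v (matrix_inv A *v axis l 1) = axis l 1"
    by (simp add: matrix_vector_mul_assoc)
  then have "matrix_inv A *v axis l 1 = (\<chi> k. det (\<chi> i j. if j = k then axis l 1 $ i else A $ i $ j) / det A)"
    by (simp only: cramer[OF assms])
  from arg_cong[OF this, of "\<lambda>v. v $ k"] show ?thesis
    by (simp add: matrix_vector_mult_def axis_def if_distrib cong: if_cong)
qed

text \<open>
  By Cramer's rule the entries of the inverse are quotients of determinants, and the denominator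
  is eventually nonzero.
\<close>
lemma tendsto_matrix_inv:
  fixes A :: "'a \<Rightarrow> 'b::{real_normed_field}^'n^'n"
  assumes A: "(A \<longlongrightarrow> M) F" and M: "det M \<noteq> 0"
  shows "((\<lambda>y. matrix_inv (A y) $ k $ l) \<longlongrightarrow> matrix_inv M $ k $ l) F"
proof -
  have comp: "((\<lambda>y. A y $ i $ j) \<longlongrightarrow> M $ i $ j) F" for i j
    by (intro tendsto_vec_nth A)
  have det: "((\<lambda>y. det (A y)) \<longlongrightarrow> det M) F"
    by (rule tendsto_det) (rule comp)
  have "((\<lambda>y. det (\<chi> i j. if j = k then axis l 1 $ i else A y $ i $ j) / det (A y))
      \<longlongrightarrow> det (\<chi> i j. if j = k then axis l 1 $ i else M $ i $ j) / det M) F"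
    by (intro tendsto_divide det M tendsto_det) (simp add: comp)
  then show ?thesis
    unfolding matrix_inv_cramer[OF M]
  proof (rule Lim_transform_eventually)
    show "\<forall>\<^sub>F y in F. det (\<chi> i j. if j = k then axis l 1 $ i else A y $ i $ j) / det (A y) = matrix_inv (A y) $ k $ l"
      using tendsto_imp_eventually_ne[OF det M] by eventually_elim (simp add: matrix_inv_cramer)
  qed
qed

text \<open>
  A product rule in which one factor is merely continuous, at a zero of the other one. It gives
  the derivative of the Christoffel symbols at the centre without differentiating the inverse
  of the metric.
\<close>
lemma has_derivative_mult_vanishing:
  fixes N A :: "'a::real_normed_vector \<Rightarrow> real"
  assumes A: "(A has_derivative A') (at x)" "A x = 0" and N: "(N \<longlongrightarrow> N x) (at x)"
  shows "((\<lambda>y. N y * A y) has_derivative (\<lambda>v. N x * A' v)) (at x)"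
  unfolding has_derivative_iff_norm
proof
  interpret bounded_linear A' using A(1) by (rule has_derivative_bounded_linear)
  show "bounded_linear (\<lambda>v. N x * A' v)"
    by (rule bounded_linear_mult_right[THEN bounded_linear_compose]) unfold_locales
  obtain K where K: "\<And>v. norm (A' v) \<le> norm v * K" using bounded by blast
  have lim: "((\<lambda>y. norm (A y - A x - A' (y - x)) / norm (y - x)) \<longlongrightarrow> 0) (at x)"
    using A(1) unfolding has_derivative_iff_norm by blast
  show "((\<lambda>y. norm (N y * A y - N x * A x - N x * A' (y - x)) / norm (y - x)) \<longlongrightarrow> 0) (at x)"
  proof (rule Lim_null_comparison)
    have "((\<lambda>y. \<bar>N y\<bar> * (norm (A y - A x - A' (y - x)) / norm (y - x)) + \<bar>N y - N x\<bar> * K)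
        \<longlongrightarrow> \<bar>N x\<bar> * 0 + \<bar>N x - N x\<bar> * K) (at x)"
      by (intro tendsto_intros lim N)
    then show "((\<lambda>y. \<bar>N y\<bar> * (norm (A y - A x - A' (y - x)) / norm (y - x)) + \<bar>N y - N x\<bar> * K) \<longlongrightarrow> 0) (at x)"
      by simp
    show "\<forall>\<^sub>F y in at x. norm (norm (N y * A y - N x * A x - N x * A' (y - x)) / norm (y - x))
       \<le> \<bar>N y\<bar> * (norm (A y - A x - A' (y - x)) / norm (y - x)) + \<bar>N y - N x\<bar> * K"
    proof (rule eventually_at_topological[THEN iffD2], intro exI[of _ UNIV] conjI ballI impI)
      fix y assume "y \<noteq> x"
      then have pos: "norm (y - x) > 0" by simp
      have "N y * A y - N x * A x - N x * A' (y - x) = N y * (A y - A x - A' (y - x)) + (N y - N x) * A' (y - x)"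
        using A(2) by (simp add: algebra_simps)
      then have "norm (N y * A y - N x * A x - N x * A' (y - x))
          \<le> \<bar>N y\<bar> * norm (A y - A x - A' (y - x)) + \<bar>N y - N x\<bar> * norm (A' (y - x))"
        using norm_triangle_ineq[of "N y * (A y - A x - A' (y - x))" "(N y - N x) * A' (y - x)"]
        by (simp only: abs_mult real_norm_def)
      also have "\<dots> \<le> \<bar>N y\<bar> * norm (A y - A x - A' (y - x)) + \<bar>N y - N x\<bar> * (norm (y - x) * K)"
        using K[of "y - x"] by (intro add_left_mono mult_left_mono) auto
      finally have "norm (N y * A y - N x * A x - N x * A' (y - x)) / norm (y - x)
          \<le> (\<bar>N y\<bar> * norm (A y - A x - A' (y - x)) + \<bar>N y - N x\<bar> * (norm (y - x) * K)) / norm (y - x)"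
        by (rule divide_right_mono) simp
      also have "\<dots> = \<bar>N y\<bar> * (norm (A y - A x - A' (y - x)) / norm (y - x)) + \<bar>N y - N x\<bar> * K"
        using \<open>y \<noteq> x\<close> by (simp add: add_divide_distrib)
      finally show "norm (norm (N y * A y - N x * A x - N x * A' (y - x)) / norm (y - x))
       \<le> \<bar>N y\<bar> * (norm (A y - A x - A' (y - x)) / norm (y - x)) + \<bar>N y - N x\<bar> * K"
        by simp
    qed auto
  qed
qed


section \<open>Second-order geometry at the centre of normal coordinates\<close>

lemma sum_axis: "(\<Sum>i\<in>UNIV. axis a 1 $ i * f i) = (f a :: real)"
  by (simp add: axis_def mult_delta_left)

lemma quadratic_form_polarization:
  fixes T :: "'n::finite \<Rightarrow> 'n \<Rightarrow> real"
  assumes "\<And>v::real^'n. (\<Sum>i\<in>UNIV. \<Sum>j\<in>UNIV. T i j * v $ i * v $ j) = 0"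
  shows "T i j + T j i = 0"
proof -
  define B where "B u v = (\<Sum>i\<in>UNIV. \<Sum>j\<in>UNIV. T i j * u $ i * v $ j)" for u v :: "real^'n"
  have add: "B (u + u') v = B u v + B u' v" "B u (v + v') = B u v + B u v'" for u u' v v'
    by (simp_all add: B_def algebra_simps sum.distrib)
  have axis: "B (axis i 1) (axis j 1) = T i j" for i j
    by (simp add: B_def axis_def mult_delta_right mult_delta_left)
  have "B v v = 0" for v
    using assms by (simp add: B_def)
  from this[of "axis i 1 + axis j 1"] this[of "axis i 1"] this[of "axis j 1"]
  show ?thesis by (simp add: add axis)
qed

text \<open>
  Inclusion and exclusion over the nonempty subsets of three basis vectors isolates the fully
  symmetrised coefficient. A quadratic form is treated in the same way with two vectors.
\<close>
lemma cubic_form_polarization: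
  fixes T :: "'n::finite \<Rightarrow> 'n \<Rightarrow> 'n \<Rightarrow> real"
  assumes "\<And>v::real^'n. (\<Sum>a\<in>UNIV. \<Sum>i\<in>UNIV. \<Sum>j\<in>UNIV. T a i j * v $ a * v $ i * v $ j) = 0"
  shows "T a i j + T a j i + T i a j + T i j a + T j a i + T j i a = 0"
proof -
  define B where "B u v w = (\<Sum>a\<in>UNIV. \<Sum>i\<in>UNIV. \<Sum>j\<in>UNIV. T a i j * u $ a * v $ i * w $ j)"
    for u v w :: "real^'n"
  have add: "B (u + u') v w = B u v w + B u' v w" "B u (v + v') w = B u v w + B u v' w"
    "B u v (w + w') = B u v w + B u v w'" for u u' v v' w w'
    by (simp_all add: B_def algebra_simps sum.distrib)
  have axis: "B (axis a 1) (axis i 1) (axis j 1) = T a i j" for a i j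
    by (simp add: B_def axis_def mult_delta_right mult_delta_left)
  have "B v v v = 0" for v
    using assms by (simp add: B_def)
  note this[of "axis a 1 + axis i 1 + axis j 1"] this[of "axis a 1 + axis i 1"] this[of "axis a 1 + axis j 1"]
    this[of "axis i 1 + axis j 1"] this[of "axis a 1"] this[of "axis i 1"] this[of "axis j 1"]
  then show ?thesis by (simp add: add axis)
qed

text \<open>
  Used to extend the vanishing of homogeneous forms from a neighbourhood of the origin to the
  whole space.
\<close>
lemma scaled_mem_open:
  fixes v :: "'a::real_normed_vector"
  assumes "open U" "0 \<in> U"
  obtains s :: real where "s > 0" "s *\<^sub>R v \<in> U"
proof -
  have "((\<lambda>s::real. s *\<^sub>R v) \<longlongrightarrow> 0 *\<^sub>R v) (at_right 0)"
    by (intro tendsto_intros)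
  then have "\<forall>\<^sub>F s in at_right (0::real). s *\<^sub>R v \<in> U"
    using assms by (intro topological_tendstoD) auto
  moreover have "\<forall>\<^sub>F s in at_right (0::real). s > 0"
    by (simp add: eventually_at_right_less)
  ultimately have "\<forall>\<^sub>F s in at_right (0::real). s > 0 \<and> s *\<^sub>R v \<in> U"
    by eventually_elim simp
  then obtain s :: real where "s > 0 \<and> s *\<^sub>R v \<in> U"
    using eventually_happens'[OF trivial_limit_at_right_real] by blast
  then show ?thesis using that by blast
qed

text \<open>
  The metric of a normal chart in its own coordinates. The point at the centre corresponds to the
  origin and \<open>U\<close> to the image of the chart, so that the manifold disappears from the argument.
\<close>
locale normal_coordinates =
  fixes G :: "real^4 \<Rightarrow> real^4^4" and U :: "(real^4) set"
  assumes smooth: "smooth_on U G"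
    and sym: "\<And>y i j. y \<in> U \<Longrightarrow> G y $ i $ j = G y $ j $ i"
    and zero_mem: "0 \<in> U"
    and center: "G 0 = mat 1"
    and rays: "\<And>v. v \<in> U \<Longrightarrow> geodesic_on G {0..1} (\<lambda>t. t *\<^sub>R v)"
begin

lemma open_U: "open U"
  using smooth by (simp add: smooth_on_def)

definition metric_hessian :: "4 \<Rightarrow> 4 \<Rightarrow> 4 \<Rightarrow> 4 \<Rightarrow> real" where
  "metric_hessian a b i j = partial_deriv a (partial_deriv b (\<lambda>z. G z $ i $ j)) 0"

abbreviation D\<Gamma> :: "4 \<Rightarrow> 4 \<Rightarrow> 4 \<Rightarrow> 4 \<Rightarrow> real" where
  "D\<Gamma> a i j k \<equiv> partial_deriv a (christoffel G i j k) 0"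

lemma smooth_component: "smooth_on U (\<lambda>z. G z $ i $ j)"
  using smooth by (intro smooth_on_vec_nth)

lemma metric_hessian_commute: "metric_hessian a b i j = metric_hessian b a i j"
  unfolding metric_hessian_def by (rule partial_deriv_commute[OF smooth_component zero_mem])

lemma partial_deriv_metric_sym: 
  "y \<in> U \<Longrightarrow> partial_deriv b (\<lambda>z. G z $ i $ j) y = partial_deriv b (\<lambda>z. G z $ j $ i) y"
  by (rule partial_deriv_cong[OF open_U]) (simp_all add: sym)

lemma metric_hessian_sym: "metric_hessian a b i j = metric_hessian a b j i"
  unfolding metric_hessian_def by (rule partial_deriv_cong[OF open_U zero_mem]) (rule partial_deriv_metric_sym)

lemma matrix_inv_center: "matrix_inv (G 0) = mat 1"
  unfolding center matrix_inv_def by (rule some_equality) auto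

lemma christoffel_zero_eq:
  "christoffel G i j k 0 = (partial_deriv j (\<lambda>z. G z $ i $ k) 0
     + partial_deriv i (\<lambda>z. G z $ j $ k) 0 - partial_deriv k (\<lambda>z. G z $ i $ j) 0) / 2"
  unfolding christoffel_def matrix_inv_center
  by (simp add: mat_def mult_delta_left)

text \<open>
  The ray has constant velocity \<open>v\<close> on the whole closed interval, so the acceleration in the
  geodesic equation is zero, also at its endpoints, where only one-sided derivatives are available.
\<close>
lemma ray_equation:
  assumes v: "v \<in> U" and t: "t \<in> {0..1}"
  shows "(\<Sum>i\<in>UNIV. \<Sum>j\<in>UNIV. christoffel G i j k (t *\<^sub>R v) * v $ i * v $ j) = 0"
proof -
  obtain x' x'' where x': "\<And>t. t \<in> {0..1} \<Longrightarrow> ((\<lambda>t. t *\<^sub>R v) has_vector_derivative x' t) (at t within {0..1})"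
    and x'': "\<And>t. t \<in> {0..1} \<Longrightarrow> (x' has_vector_derivative x'' t) (at t within {0..1})"
    and eq: "\<And>t k. t \<in> {0..1} \<Longrightarrow> x'' t $ k + (\<Sum>i\<in>UNIV. \<Sum>j\<in>UNIV. christoffel G i j k (t *\<^sub>R v) * x' t $ i * x' t $ j) = 0"
    using rays[OF v] unfolding geodesic_on_def by blast
  have v': "x' t = v" if "t \<in> {0..1}" for t
  proof (rule vector_derivative_unique_within_closed_interval[of 0 1 t])
    show "((\<lambda>t. t *\<^sub>R v) has_vector_derivative v) (at t within cbox 0 1)"
      by (auto intro!: derivative_eq_intros)
  qed (use that x' in auto)
  have "x'' t = 0"
  proof (rule vector_derivative_unique_within_closed_interval[of 0 1 t])
    show "(x' has_vector_derivative 0) (at t within cbox 0 1)"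
      by (rule has_vector_derivative_transform[where f="\<lambda>_. v"]) (use t v' in auto)
  qed (use t x'' in auto)
  with eq[OF t, of k] v'[OF t] show ?thesis by simp
qed

lemma christoffel_zero: "christoffel G i j k 0 = 0"
proof -
  have "(\<Sum>i\<in>UNIV. \<Sum>j\<in>UNIV. christoffel G i j k 0 * v $ i * v $ j) = 0" for v :: "real^4"
  proof -
    obtain s :: real where s: "s > 0" "s *\<^sub>R v \<in> U"
      using scaled_mem_open[OF open_U zero_mem] .
    have "s\<^sup>2 * (\<Sum>i\<in>UNIV. \<Sum>j\<in>UNIV. christoffel G i j k 0 * v $ i * v $ j) = 0"
      using ray_equation[OF s(2), of 0 k] by (simp add: sum_distrib_left power2_eq_square mult_ac)
    then show ?thesis using s(1) by simp
  qed
  from quadratic_form_polarization[OF this, of i j] 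
  have "christoffel G i j k 0 + christoffel G j i k 0 = 0" .
  moreover have "christoffel G j i k 0 = christoffel G i j k 0"
    unfolding christoffel_zero_eq using partial_deriv_metric_sym[OF zero_mem, of k i j] by simp
  ultimately show ?thesis by simp
qed

text \<open>
  The identity \<open>\<partial>\<^sub>b g\<^sub>i\<^sub>j = \<Gamma>\<^sub>i\<^sub>b\<^sup>j + \<Gamma>\<^sub>j\<^sub>b\<^sup>i\<close> holds where the metric is
  the identity matrix.
\<close>
lemma metric_deriv_zero: "partial_deriv b (\<lambda>z. G z $ i $ j) 0 = 0"
proof -
  \<comment> \<open>Here \<open>p, q, r\<close> are the derivatives of the metric by \<open>b, i, j\<close>, with the other two as components.\<close>
  have solve: "p = 0" if "(p + q - r) / 2 = 0" "(p' + r' - q') / 2 = 0" "p' = p" "q' = q" "r' = r"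
    for p q r p' q' r' :: real
    using that by (simp add: field_simps)
  show ?thesis
    by (rule solve[OF christoffel_zero[of i b j, unfolded christoffel_zero_eq]
        christoffel_zero[of j b i, unfolded christoffel_zero_eq]]; rule partial_deriv_metric_sym[OF zero_mem])
qed

text \<open>
  The brackets in the Christoffel symbols are first derivatives of the metric, so they vanish at
  the centre, and the inverse metric contributes only its value there.
\<close>
lemma christoffel_has_derivative:
  "(christoffel G i j k has_derivative
     (\<lambda>v. \<Sum>a\<in>UNIV. v $ a * ((metric_hessian a j i k + metric_hessian a i j k - metric_hessian a k i j) / 2))) (at 0)"
proof -
  let ?A = "\<lambda>l y. partial_deriv j (\<lambda>z. G z $ i $ l) y + partial_deriv i (\<lambda>z. G z $ j $ l) y
        - partial_deriv l (\<lambda>z. G z $ i $ j) y"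
  let ?A' = "\<lambda>l v. \<Sum>a\<in>UNIV. v $ a * (metric_hessian a j i l + metric_hessian a i j l - metric_hessian a l i j)"
  have first: "(partial_deriv b (\<lambda>z. G z $ i $ j) has_derivative (\<lambda>v. \<Sum>a\<in>UNIV. v $ a *\<^sub>R metric_hessian a b i j)) (at 0)" for b i j
    unfolding metric_hessian_def by (intro has_derivative_partial_derivs smooth_on_differentiable[OF _ zero_mem] smooth_on_partial_deriv smooth_component)
  have A: "(?A l has_derivative ?A' l) (at 0)" for l
    using has_derivative_diff[OF has_derivative_add[OF first[of j i l] first[of i j l]] first[of l i j]]
    by (simp add: sum.distrib sum_subtractf algebra_simps)
  have inv: "((\<lambda>y. matrix_inv (G y) $ k $ l) \<longlongrightarrow> matrix_inv (G 0) $ k $ l) (at 0)" for l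
    using smooth_on_isCont[OF smooth zero_mem] by (intro tendsto_matrix_inv) (auto simp: isCont_def center)
  have "((\<lambda>y. matrix_inv (G y) $ k $ l * ?A l y) has_derivative (\<lambda>v. matrix_inv (G 0) $ k $ l * ?A' l v)) (at 0)" for l
    by (rule has_derivative_mult_vanishing[OF A _ inv]) (simp add: metric_deriv_zero)
  then have "((\<lambda>y. 1/2 * (\<Sum>l\<in>UNIV. matrix_inv (G y) $ k $ l * ?A l y)) has_derivative
      (\<lambda>v. 1/2 * (\<Sum>l\<in>UNIV. matrix_inv (G 0) $ k $ l * ?A' l v))) (at 0)"
    by (intro has_derivative_mult_right has_derivative_sum)
  moreover have "christoffel G i j k = (\<lambda>y. 1/2 * (\<Sum>l\<in>UNIV. matrix_inv (G y) $ k $ l * ?A l y))"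
    by (simp add: fun_eq_iff christoffel_def)
  moreover have "1/2 * (\<Sum>l\<in>UNIV. matrix_inv (G 0) $ k $ l * ?A' l v)
      = (\<Sum>a\<in>UNIV. v $ a * ((metric_hessian a j i k + metric_hessian a i j k - metric_hessian a k i j) / 2))" for v
    unfolding matrix_inv_center
    by (simp add: mat_def mult_delta_left sum_divide_distrib)
  ultimately show ?thesis by simp
qed

lemma D\<Gamma>_eq: "D\<Gamma> a i j k = (metric_hessian a j i k + metric_hessian a i j k - metric_hessian a k i j) / 2"
  unfolding partial_deriv_has_derivative[OF christoffel_has_derivative] by (rule sum_axis)

text \<open>
  Differentiating \<open>\<Gamma>\<^sub>i\<^sub>j\<^sup>k(t v) v\<^sup>i v\<^sup>j = 0\<close> at \<open>t = 0\<close> gives a cubic form in \<open>v\<close> that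
  vanishes near the origin, hence everywhere. Polarization then symmetrises its coefficients over
  the three lower indices.
\<close>
lemma D\<Gamma>_cyclic: "D\<Gamma> a i j k + D\<Gamma> i j a k + D\<Gamma> j a i k = 0"
proof -
  have deriv: "(christoffel G i j k has_derivative (\<lambda>v. \<Sum>a\<in>UNIV. v $ a * D\<Gamma> a i j k)) (at 0)" for i j
    using christoffel_has_derivative unfolding D\<Gamma>_eq .
  have "(\<Sum>a\<in>UNIV. \<Sum>i\<in>UNIV. \<Sum>j\<in>UNIV. D\<Gamma> a i j k * v $ a * v $ i * v $ j) = 0" for v :: "real^4"
  proof -
    \<comment> \<open>The ray equation is available only in \<open>U\<close>, so rescale \<open>v\<close> and use homogeneity at the end.\<close>
    obtain s :: real where s: "s > 0" "s *\<^sub>R v \<in> U"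
      using scaled_mem_open[OF open_U zero_mem] .
    define w where "w = s *\<^sub>R v"
    let ?\<phi> = "\<lambda>t. \<Sum>i\<in>UNIV. \<Sum>j\<in>UNIV. christoffel G i j k (t *\<^sub>R w) * w $ i * w $ j"
    have "((\<lambda>t. christoffel G i j k (t *\<^sub>R w)) has_derivative (\<lambda>t. \<Sum>a\<in>UNIV. (t *\<^sub>R w) $ a * D\<Gamma> a i j k)) (at 0 within {0..1})" for i j
      by (rule has_derivative_compose[where f="\<lambda>t. t *\<^sub>R w"])
         (use deriv in \<open>auto intro!: derivative_eq_intros\<close>)
    then have "(?\<phi> has_derivative (\<lambda>t. \<Sum>i\<in>UNIV. \<Sum>j\<in>UNIV. (\<Sum>a\<in>UNIV. (t *\<^sub>R w) $ a * D\<Gamma> a i j k) * w $ i * w $ j)) (at 0 within {0..1})"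
      by (intro has_derivative_sum has_derivative_mult_left)
    moreover have "(\<Sum>i\<in>UNIV. \<Sum>j\<in>UNIV. (\<Sum>a\<in>UNIV. (t *\<^sub>R w) $ a * D\<Gamma> a i j k) * w $ i * w $ j)
       = t *\<^sub>R (\<Sum>i\<in>UNIV. \<Sum>j\<in>UNIV. \<Sum>a\<in>UNIV. D\<Gamma> a i j k * w $ a * w $ i * w $ j)" for t
      by (simp add: sum_distrib_left sum_distrib_right mult_ac)
    ultimately have "(?\<phi> has_vector_derivative (\<Sum>i\<in>UNIV. \<Sum>j\<in>UNIV. \<Sum>a\<in>UNIV. D\<Gamma> a i j k * w $ a * w $ i * w $ j)) (at 0 within cbox 0 1)"
      by (simp add: has_vector_derivative_def)
    moreover have "(?\<phi> has_vector_derivative 0) (at 0 within cbox 0 1)"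
      by (rule has_vector_derivative_transform[where f="\<lambda>_. 0"])
         (use ray_equation[of w] s in \<open>auto simp: w_def\<close>)
    ultimately have "(\<Sum>i\<in>UNIV. \<Sum>j\<in>UNIV. \<Sum>a\<in>UNIV. D\<Gamma> a i j k * w $ a * w $ i * w $ j) = 0"
      by (intro vector_derivative_unique_within_closed_interval[of 0 1 0]) auto
    also have "(\<Sum>i\<in>UNIV. \<Sum>j\<in>UNIV. \<Sum>a\<in>UNIV. D\<Gamma> a i j k * w $ a * w $ i * w $ j)
       = (\<Sum>a\<in>UNIV. \<Sum>i\<in>UNIV. \<Sum>j\<in>UNIV. D\<Gamma> a i j k * w $ a * w $ i * w $ j)"
      by (subst (2) sum.swap, subst sum.swap) (rule refl)
    also have "\<dots> = s^3 * (\<Sum>a\<in>UNIV. \<Sum>i\<in>UNIV. \<Sum>j\<in>UNIV. D\<Gamma> a i j k * v $ a * v $ i * v $ j)"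
      by (simp add: w_def sum_distrib_left power3_eq_cube mult_ac)
    finally show ?thesis using s(1) by simp
  qed
  from cubic_form_polarization[OF this, of a i j]
  have "D\<Gamma> a i j k + D\<Gamma> a j i k + D\<Gamma> i a j k + D\<Gamma> i j a k + D\<Gamma> j a i k + D\<Gamma> j i a k = 0" .
  moreover have "D\<Gamma> a i j k = D\<Gamma> a j i k" for a i j
    unfolding D\<Gamma>_eq using metric_hessian_sym[of a k i j] by simp
  note this[of a j i] this[of i j a] this[of j i a]
  ultimately show ?thesis by linarith
qed

lemma riemann_center: "riemann G i j k l 0 = D\<Gamma> k l j i - D\<Gamma> l k j i"
  unfolding riemann_def center
  by (simp add: christoffel_zero mat_def mult_delta_left)

lemma riemann_antisym: "riemann G j i k l 0 = - riemann G i j k l 0"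
  unfolding riemann_center D\<Gamma>_eq by (simp only: metric_hessian_commute metric_hessian_sym) argo

text \<open>
  In terms of second derivatives of the metric, the left-hand side is
  \<open>\<partial>\<^sub>a\<partial>\<^sub>j g\<^sub>i\<^sub>k - \<partial>\<^sub>a\<partial>\<^sub>k g\<^sub>i\<^sub>j\<close>, while the curvature is half the sum of this and
  of \<open>\<partial>\<^sub>i\<partial>\<^sub>k g\<^sub>a\<^sub>j - \<partial>\<^sub>i\<partial>\<^sub>j g\<^sub>a\<^sub>k\<close>. The difference of the two cyclic identities that
  are obtained from each other by exchanging \<open>j\<close> and \<open>k\<close> says that both terms agree.
\<close>
lemma D\<Gamma>_antisym: "D\<Gamma> a i j k - D\<Gamma> a i k j = riemann G a i k j 0"
  using D\<Gamma>_cyclic[of a i j k] D\<Gamma>_cyclic[of a i k j]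
  unfolding riemann_center D\<Gamma>_eq by (simp only: metric_hessian_commute metric_hessian_sym) argo

end


section \<open>Contracting Christoffel derivatives to the curvature four-form\<close>

context normal_coordinates
begin

lemma christoffel_contraction_eq_trace:
  "(\<Sum>a\<in>UNIV. \<Sum>i\<in>UNIV. \<Sum>j\<in>UNIV. \<Sum>k\<in>UNIV. \<Sum>m\<in>UNIV. \<Sum>n\<in>UNIV.
     D\<Gamma> a i j k * D\<Gamma> a i m n * volume4 v k j n m) = - trace_R_wedge_R G 0 v"
  unfolding contract_alternating4[OF alternating4_volume4] D\<Gamma>_antisym trace_R_wedge_R_eq
    sum_negf[symmetric] sum_distrib_left
  by (intro sum.cong refl) (subst riemann_antisym, simp)

text \<open>
  The supertrace of each product of spin generators is traded for a coordinate four-form, with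
  factor \<open>- 1 / 4\<close>: a factor \<open>- 4\<close> from the supertrace of
  \<open>\<gamma>\<^sub>1 \<gamma>\<^sub>2 \<gamma>\<^sub>3 \<gamma>\<^sub>4\<close> and \<open>1 / 16\<close> from the normalisation of the two generators.
\<close>
lemma supertrace_contraction:
  assumes cl: "clifford_gammas \<gamma>"
  shows "supertrace \<gamma> (\<Sum>a\<in>UNIV. \<Sum>i\<in>UNIV. \<Sum>j\<in>UNIV. \<Sum>k\<in>UNIV. \<Sum>m\<in>UNIV. \<Sum>n\<in>UNIV.
      (D\<Gamma> a i j k * D\<Gamma> a i m n) *\<^sub>R (spin_gen \<gamma> k j ** spin_gen \<gamma> n m)) * complex_of_real (coord_volume v)
    = complex_of_real (1/4 * trace_R_wedge_R G 0 v)"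
proof -
  have spin: "supertrace \<gamma> (spin_gen \<gamma> k j ** spin_gen \<gamma> n m) * complex_of_real (coord_volume v)
      = complex_of_real (- 1/4 * volume4 v k j n m)" for k j n m
  proof -
    have "alternating4 (\<lambda>k l m n. complex_of_real (volume4 v k l m n))"
      using alternating4_volume4[of v] unfolding alternating4_def by (metis of_real_minus)
    from alternating4_proportional[OF alternating4_supertrace[OF cl] this, of k j n m]
    show ?thesis
      unfolding supertrace_spin_gen[OF cl] coord_volume_eq_volume4 supertrace_volume[OF cl] by simp
  qed
  have "supertrace \<gamma> (\<Sum>a\<in>UNIV. \<Sum>i\<in>UNIV. \<Sum>j\<in>UNIV. \<Sum>k\<in>UNIV. \<Sum>m\<in>UNIV. \<Sum>n\<in>UNIV.
      (D\<Gamma> a i j k * D\<Gamma> a i m n) *\<^sub>R (spin_gen \<gamma> k j ** spin_gen \<gamma> n m)) * complex_of_real (coord_volume v)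
    = (\<Sum>a\<in>UNIV. \<Sum>i\<in>UNIV. \<Sum>j\<in>UNIV. \<Sum>k\<in>UNIV. \<Sum>m\<in>UNIV. \<Sum>n\<in>UNIV.
      (D\<Gamma> a i j k * D\<Gamma> a i m n) *\<^sub>R (supertrace \<gamma> (spin_gen \<gamma> k j ** spin_gen \<gamma> n m) * complex_of_real (coord_volume v)))"
    by (simp only: linear_sum[OF linear_supertrace] supertrace_scaleR sum_distrib_right mult_scaleR_left)
  also have "\<dots> = complex_of_real (- 1/4 * (\<Sum>a\<in>UNIV. \<Sum>i\<in>UNIV. \<Sum>j\<in>UNIV. \<Sum>k\<in>UNIV. \<Sum>m\<in>UNIV. \<Sum>n\<in>UNIV.
     D\<Gamma> a i j k * D\<Gamma> a i m n * volume4 v k j n m))"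
    unfolding spin sum_distrib_left of_real_sum by (intro sum.cong refl) (simp add: scaleR_conv_of_real)
  also have "\<dots> = complex_of_real (1/4 * trace_R_wedge_R G 0 v)"
    unfolding christoffel_contraction_eq_trace by simp
  finally show ?thesis .
qed

end

lemma (in closed_riemannian_4manifold) normal_chart_normal_coordinates:
  assumes "normal_chart A g p c"
  shows "normal_coordinates (metric_coords g c) (snd c ` fst c)"
proof
  have c: "c \<in> A" "p \<in> fst c" "snd c p = 0" "g c p = mat 1"
    and geo: "\<And>v. v \<in> snd c ` fst c \<Longrightarrow> geodesic_on (metric_coords g c) {0..1} (\<lambda>t. t *\<^sub>R v)"
    using assms unfolding normal_chart_def by blast+
  show "smooth_on (snd c ` fst c) (metric_coords g c)"
    by (rule metric_smooth[OF c(1)])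
  show "metric_coords g c y $ i $ j = metric_coords g c y $ j $ i" if "y \<in> snd c ` fst c" for y i j
  proof -
    have "transpose (metric_coords g c y) = metric_coords g c y"
      unfolding metric_coords_def chart_inv_def by (rule metric_sym[OF c(1)]) (rule inv_into_into[OF that])
    from arg_cong[OF this, of "\<lambda>M. M $ j $ i"] show ?thesis by (simp add: transpose_def)
  qed
  show "0 \<in> snd c ` fst c" using c(2,3) by force
  have "is_chart X c" by (rule charts[OF c(1)])
  then have "inj_on (snd c) (fst c)"
    unfolding is_chart_def
    by (metis homeomorphic_imp_injective_map openin_subset topspace_subtopology_subset)
  then have "chart_inv c 0 = p"
    unfolding chart_inv_def using c(2,3) by (metis inv_into_f_f)
  then show "metric_coords g c 0 = mat 1" by (simp add: metric_coords_def c(4))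
  show "geodesic_on (metric_coords g c) {0..1} (\<lambda>t. t *\<^sub>R v)" if "v \<in> snd c ` fst c" for v
    by (rule geo[OF that])
qed

theorem proposition5:
  fixes X :: "'m topology" and A :: "'m chart set" and g :: "'m metric"
    and \<gamma>0 :: gammas and F :: "'m framed_chart set"
    and s :: "'m framed_chart \<Rightarrow> 'm framed_chart \<Rightarrow> 'm \<Rightarrow> complex^4^4"
    and p :: 'm and c :: "'m chart" and f :: "'m framed_chart"
  assumes "closed_riemannian_spin_4manifold X A g \<gamma>0 F s"
    and "normal_chart A g p c"
    and "f \<in> F" and "p \<in> frame_dom f"
  shows "let G = metric_coords g c;
             D\<Gamma> = (\<lambda>a i j k. partial_deriv a (christoffel G i j k) 0);
             \<gamma> = coord_gammas \<gamma>0 f p c;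
             \<sigma> = spin_gen \<gamma>
         in (\<lambda>v. sres \<gamma> (\<lambda>\<xi>.
                \<Sum>a\<in>UNIV. \<Sum>i\<in>UNIV. \<Sum>j\<in>UNIV. \<Sum>k\<in>UNIV. \<Sum>m\<in>UNIV. \<Sum>n\<in>UNIV.
                  (1 / norm \<xi> ^ 4 * D\<Gamma> a i j k * D\<Gamma> a i m n) *\<^sub>R (\<sigma> k j ** \<sigma> n m))
              * complex_of_real (coord_volume v))
            = (\<lambda>v. complex_of_real (1 / (32 * pi\<^sup>2) * trace_R_wedge_R G 0 v)) \<and>
            (\<lambda>v. sres \<gamma> (\<lambda>\<xi>.
                \<Sum>a\<in>UNIV. \<Sum>b\<in>UNIV. \<Sum>i\<in>UNIV. \<Sum>j\<in>UNIV. \<Sum>k\<in>UNIV. \<Sum>m\<in>UNIV. \<Sum>n\<in>UNIV.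
                  (\<xi> $ a * \<xi> $ b / norm \<xi> ^ 6 * D\<Gamma> a i j k * D\<Gamma> b i m n)
                    *\<^sub>R (\<sigma> k j ** \<sigma> n m))
              * complex_of_real (coord_volume v))
            = (\<lambda>v. complex_of_real (1 / (4 * 32 * pi\<^sup>2) * trace_R_wedge_R G 0 v))"
proof -
  interpret closed_riemannian_spin_4manifold X A g \<gamma>0 F s by fact
  interpret normal: normal_coordinates "metric_coords g c" "snd c ` fst c"
    by (rule normal_chart_normal_coordinates) fact
  define \<gamma> where "\<gamma> = coord_gammas \<gamma>0 f p c"
  define d where "d = (\<lambda>a i j k. partial_deriv a (christoffel (metric_coords g c) i j k) 0)"
  define B where "B a b = (\<Sum>i\<in>UNIV. \<Sum>j\<in>UNIV. \<Sum>k\<in>UNIV. \<Sum>m\<in>UNIV. \<Sum>n\<in>UNIV.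
      (d a i j k * d b i m n) *\<^sub>R (spin_gen \<gamma> k j ** spin_gen \<gamma> n m))" for a b
  have c: "c \<in> A" "p \<in> fst c" "g c p = mat 1"
    using assms(2) unfolding normal_chart_def by auto
  have frame: "oriented_orthonormal_frame A g f" by (rule frames) fact
  have "clifford_gammas \<gamma>"
    unfolding \<gamma>_def
  proof (rule clifford_gammas_coord_gammas[OF gammas])
    show "transpose (snd f p) ** g (fst f) p ** snd f p = mat 1"
      using frame assms(4) unfolding oriented_orthonormal_frame_def by blast
    show "g c p = transpose (transition_jac c (fst f) p) ** g (fst f) p ** transition_jac c (fst f) p"
      using frame assms(4) c unfolding oriented_orthonormal_frame_def by (intro metric_change) auto
  qed (fact c(3))
  then have B: "supertrace \<gamma> (\<Sum>a\<in>UNIV. B a a) * complex_of_real (coord_volume v)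
      = complex_of_real (1/4 * trace_R_wedge_R (metric_coords g c) 0 v)" for v
    unfolding B_def d_def by (rule normal.supertrace_contraction)
  have 1: "(\<Sum>a\<in>UNIV. \<Sum>i\<in>UNIV. \<Sum>j\<in>UNIV. \<Sum>k\<in>UNIV. \<Sum>m\<in>UNIV. \<Sum>n\<in>UNIV.
      (1 / norm \<xi> ^ 4 * d a i j k * d a i m n) *\<^sub>R (spin_gen \<gamma> k j ** spin_gen \<gamma> n m))
    = (1 / norm \<xi> ^ 4) *\<^sub>R (\<Sum>a\<in>UNIV. B a a)" for \<xi> :: "real^4"
    unfolding B_def by (simp only: scaleR_sum_right scaleR_scaleR mult.assoc)
  have 2: "(\<Sum>i\<in>UNIV. \<Sum>j\<in>UNIV. \<Sum>k\<in>UNIV. \<Sum>m\<in>UNIV. \<Sum>n\<in>UNIV.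
      (\<xi> $ a * \<xi> $ b / norm \<xi> ^ 6 * d a i j k * d b i m n) *\<^sub>R (spin_gen \<gamma> k j ** spin_gen \<gamma> n m))
    = (\<xi> $ a * \<xi> $ b / norm \<xi> ^ 6) *\<^sub>R B a b" for \<xi> :: "real^4" and a b
    unfolding B_def by (simp only: scaleR_sum_right scaleR_scaleR mult.assoc)
  have "sres \<gamma> (\<lambda>\<xi>. \<Sum>a\<in>UNIV. \<Sum>i\<in>UNIV. \<Sum>j\<in>UNIV. \<Sum>k\<in>UNIV. \<Sum>m\<in>UNIV. \<Sum>n\<in>UNIV.
      (1 / norm \<xi> ^ 4 * d a i j k * d a i m n) *\<^sub>R (spin_gen \<gamma> k j ** spin_gen \<gamma> n m))
      * complex_of_real (coord_volume v)
    = complex_of_real (1 / (32 * pi\<^sup>2) * trace_R_wedge_R (metric_coords g c) 0 v)" for v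
    unfolding 1 sres_inverse_norm unfolding mult.assoc B by simp
  moreover have "sres \<gamma> (\<lambda>\<xi>. \<Sum>a\<in>UNIV. \<Sum>b\<in>UNIV. \<Sum>i\<in>UNIV. \<Sum>j\<in>UNIV. \<Sum>k\<in>UNIV. \<Sum>m\<in>UNIV. \<Sum>n\<in>UNIV.
      (\<xi> $ a * \<xi> $ b / norm \<xi> ^ 6 * d a i j k * d b i m n) *\<^sub>R (spin_gen \<gamma> k j ** spin_gen \<gamma> n m))
      * complex_of_real (coord_volume v)
    = complex_of_real (1 / (4 * 32 * pi\<^sup>2) * trace_R_wedge_R (metric_coords g c) 0 v)" for v
    unfolding 2 sres_quadratic unfolding mult.assoc B by simp
  ultimately show ?thesis
    unfolding Let_def \<gamma>_def d_def by blast
qed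

end
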